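(* For any quandle $X$ and quandle $X$-module $\mathcal{A}=(A,\phi,\psi)$, there is an Abelian group $\operatorname{Ext}_Q(X,\mathcal{A})$, namely $\operatorname{Ext}_Q(X,\mathcal{A})=Z_Q(X,\mathcal{A})/B_Q(X,\mathcal{A})$, whose elements are in bijective correspondence with equivalence classes of quandle extensions of $X$ by $\mathcal{A}$, the class of a factor set $\sigma\in Z_Q(X,\mathcal{A})$ corresponding to the equivalence class of the extension $E[\mathcal{A},\sigma]$.
   Context: A rack is a set $X$ with a binary operation $(a,b)\mapsto a^b$ such that (R1) for all $a,b\in X$ there is a unique $c\in X$ with $c^b=a$; (R2) $(a^b)^c=(a^c)^{(b^c)}$ for all $a,b,c\in X$. A quandle is a rack with $a^a=a$ for all $a$. A homomorphism is a function $f$ with $f(a^b)=f(a)^{f(b)}$ for all $a,b$. A rack module over $X$ is a triple $\mathcal{A}=(A,\phi,\psi)$ consisting of Abelian groups $A_x$ ($x\in X$), Abelian group isomorphisms $\phi_{x,y}\colon A_x\to A_{x^y}$ and Abelian group homomorphisms $\psi_{y,x}\colon A_y\to A_{x^y}$ ($x,y\in X$), such that for all $x,y,z\in X$: $$\phi_{x^y,z}\phi_{x,y}=\phi_{x^z,y^z}\phi_{x,z},\qquad \phi_{x^y,z}\psi_{y,x}=\psi_{y^z,x^z}\phi_{y,z},$$ $$\psi_{z,x^y}(a)=\phi_{x^z,y^z}\psi_{z,x}(a)+\psi_{y^z,x^z}\psi_{z,y}(a)\quad\text{for all } a\in A_z.$$ A quandle module over a quandle $X$ is a rack module over $X$ with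 $\psi_{x,x}(a)+\phi_{x,x}(a)=a$ for all $x\in X$, $a\in A_x$. An extension of $X$ by $\mathcal{A}$ is a rack $E$ with a surjective rack homomorphism $f\colon E\to X$ and, writing $E_x=f^{-1}(x)$, for each $x\in X$ a left action of $A_x$ on $E_x$ such that: (X1) for any $u,v\in E_x$ there is a unique $a\in A_x$ with $a\cdot u=v$; (X2) $(a\cdot u)^v=\phi_{x,y}(a)\cdot(u^v)$ for all $u\in E_x$, $a\in A_x$, $v\in E_y$; (X3) $u^{(b\cdot v)}=\psi_{y,x}(b)\cdot(u^v)$ for all $u\in E_x$, $b\in A_y$, $v\in E_y$. It is a quandle extension if $E$ is a quandle. Two extensions $f_1\colon E_1\to X$, $f_2\colon E_2\to X$ of $X$ by $\mathcal{A}$ are equivalent if there is a rack isomorphism $\theta\colon E_1\to E_2$ with $f_2\theta=f_1$ and $\theta(a\cdot u)=a\cdot\theta(u)$ for all $x\in X$, $a\in A_x$, $u\in (E_1)_x$. For a family $\sigma=\{\sigma_{x,y}\in A_{x^y}: x,y\in X\}$, $E[\mathcal{A},\sigma]$ is the set $\{(a,x): x\in X, a\in A_x\}$ with operation $(a,x)^{(b,y)}=(\phi_{x,y}(a)+\sigma_{x,y}+\psi_{y,x}(b),\,x^y)$, with projection $(a,x)\mapsto x$ and $A_x$-actions $a_1\cdot(a_2,x)=(a_1+a_2,x)$. $Z_Q(X,\mathcal{A})$ is the set of families (factor sets) $\sigma=\{\sigma_{x,y}\in A_{x^y}: x,y\in X\}$ such that $\sigma_{x,x}=0$ for all $x\in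 X$ and, for all $x,y,z\in X$, $$\sigma_{x^y,z}+\phi_{x^y,z}(\sigma_{x,y})=\phi_{x^z,y^z}(\sigma_{x,z})+\sigma_{x^z,y^z}+\psi_{y^z,x^z}(\sigma_{y,z}),$$ with addition $(\sigma+\tau)_{x,y}=\sigma_{x,y}+\tau_{x,y}$. $B_Q(X,\mathcal{A})$ is the subgroup of those $\sigma$ for which there is a family $\upsilon=\{\upsilon_x\in A_x: x\in X\}$ with $\sigma_{x,y}=\phi_{x,y}(\upsilon_x)-\upsilon_{x^y}+\psi_{y,x}(\upsilon_y)$ for all $x,y\in X$. *)

theory Defs
  imports "HOL-Algebra.Group_Action" "HOL-Algebra.Product_Groups"
begin

section \<open>Racks and quandles\<close>

text \<open>\<open>a \<triangleleft> b\<close> is the exponential notation $a^b$.\<close>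

record 'a rack = "'a partial_object" +
  act :: "'a \<Rightarrow> 'a \<Rightarrow> 'a" (infixl \<open>\<triangleleft>\<index>\<close> 75)

locale rack =
  fixes X (structure)
  assumes act_closed: "\<lbrakk>a \<in> carrier X; b \<in> carrier X\<rbrakk> \<Longrightarrow> a \<triangleleft> b \<in> carrier X"
    and act_unique: "\<lbrakk>a \<in> carrier X; b \<in> carrier X\<rbrakk> \<Longrightarrow> \<exists>!c. c \<in> carrier X \<and> c \<triangleleft> b = a"
    and act_distrib: "\<lbrakk>a \<in> carrier X; b \<in> carrier X; c \<in> carrier X\<rbrakk>
          \<Longrightarrow> (a \<triangleleft> b) \<triangleleft> c = (a \<triangleleft> c) \<triangleleft> (b \<triangleleft> c)"

locale quandle = rack +
  assumes act_idem: "a \<in> carrier X \<Longrightarrow> a \<triangleleft> a = a"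

definition rack_hom :: "('a, 'm) rack_scheme \<Rightarrow> ('b, 'n) rack_scheme \<Rightarrow> ('a \<Rightarrow> 'b) set" where
  "rack_hom R S = {f \<in> carrier R \<rightarrow> carrier S.
     \<forall>a\<in>carrier R. \<forall>b\<in>carrier R. f (a \<triangleleft>\<^bsub>R\<^esub> b) = f a \<triangleleft>\<^bsub>S\<^esub> f b}"

definition rack_iso :: "('a, 'm) rack_scheme \<Rightarrow> ('b, 'n) rack_scheme \<Rightarrow> ('a \<Rightarrow> 'b) set" where
  "rack_iso R S = {f \<in> rack_hom R S. bij_betw f (carrier R) (carrier S)}"


section \<open>Modules\<close>

text \<open>
  The Abelian groups \<open>A x\<close> are \<^locale>\<open>comm_group\<close>s, so their addition is written \<open>\<otimes>\<close>, their zero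
  \<open>\<one>\<close> and negation \<open>inv\<close>. The index order of \<open>\<psi>\<close> is the mathematical one: \<open>\<psi> y x\<close> maps \<open>A y\<close>
  to \<open>A (x \<triangleleft> y)\<close>.
\<close>

locale rack_module = rack X
  for X :: "('x, 'r) rack_scheme" (structure)
    and A :: "'x \<Rightarrow> ('a, 'm) monoid_scheme"
    and \<phi> \<psi> :: "'x \<Rightarrow> 'x \<Rightarrow> 'a \<Rightarrow> 'a" +
  assumes comm_group: "x \<in> carrier X \<Longrightarrow> comm_group (A x)"
    and phi_iso: "\<lbrakk>x \<in> carrier X; y \<in> carrier X\<rbrakk> \<Longrightarrow> \<phi> x y \<in> iso (A x) (A (x \<triangleleft> y))"
    and psi_hom: "\<lbrakk>x \<in> carrier X; y \<in> carrier X\<rbrakk> \<Longrightarrow> \<psi> y x \<in> hom (A y) (A (x \<triangleleft> y))"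
    and phi_phi: "\<lbrakk>x \<in> carrier X; y \<in> carrier X; z \<in> carrier X; a \<in> carrier (A x)\<rbrakk>
          \<Longrightarrow> \<phi> (x \<triangleleft> y) z (\<phi> x y a) = \<phi> (x \<triangleleft> z) (y \<triangleleft> z) (\<phi> x z a)"
    and phi_psi: "\<lbrakk>x \<in> carrier X; y \<in> carrier X; z \<in> carrier X; a \<in> carrier (A y)\<rbrakk>
          \<Longrightarrow> \<phi> (x \<triangleleft> y) z (\<psi> y x a) = \<psi> (y \<triangleleft> z) (x \<triangleleft> z) (\<phi> y z a)"
    and psi_psi: "\<lbrakk>x \<in> carrier X; y \<in> carrier X; z \<in> carrier X; a \<in> carrier (A z)\<rbrakk>
          \<Longrightarrow> \<psi> z (x \<triangleleft> y) a =
              \<phi> (x \<triangleleft> z) (y \<triangleleft> z) (\<psi> z x a)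
                \<otimes>\<^bsub>A ((x \<triangleleft> y) \<triangleleft> z)\<^esub> \<psi> (y \<triangleleft> z) (x \<triangleleft> z) (\<psi> z y a)"

locale quandle_module = rack_module + quandle +
  assumes psi_phi_idem: "\<lbrakk>x \<in> carrier X; a \<in> carrier (A x)\<rbrakk> \<Longrightarrow> \<psi> x x a \<otimes>\<^bsub>A x\<^esub> \<phi> x x a = a"


section \<open>Extensions\<close>

text \<open>
  \<open>gact E x a u\<close> is $a \cdot u$ for $a \in A_x$ and $u \in E_x$.
\<close>

record ('e, 'x, 'a) extension = "'e rack" +
  proj :: "'e \<Rightarrow> 'x"
  gact :: "'x \<Rightarrow> 'a \<Rightarrow> 'e \<Rightarrow> 'e"

definition fibre :: "('e, 'x, 'a) extension \<Rightarrow> 'x \<Rightarrow> 'e set" where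
  "fibre E x = {u \<in> carrier E. proj E u = x}"

text \<open>
  The library's \<^const>\<open>group_action\<close> is a homomorphism into \<^const>\<open>BijGroup\<close>, whose elements are
  extensional; hence \<open>gact E x a\<close> is required to be \<open>undefined\<close> off the fibre.
\<close>

locale rack_extension = rack_module X A \<phi> \<psi> + total: rack E
  for X :: "('x, 'r) rack_scheme" (structure)
    and A :: "'x \<Rightarrow> ('a, 'm) monoid_scheme"
    and \<phi> \<psi> :: "'x \<Rightarrow> 'x \<Rightarrow> 'a \<Rightarrow> 'a"
    and E :: "('e, 'x, 'a) extension" +
  assumes proj_hom: "proj E \<in> rack_hom E X"
    and proj_surj: "proj E ` carrier E = carrier X"
    and action: "x \<in> carrier X \<Longrightarrow> group_action (A x) (fibre E x) (gact E x)"
    and X1: "\<lbrakk>x \<in> carrier X; u \<in> fibre E x; v \<in> fibre E x\<rbrakk>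
          \<Longrightarrow> \<exists>!a. a \<in> carrier (A x) \<and> gact E x a u = v"
    and X2: "\<lbrakk>x \<in> carrier X; y \<in> carrier X; u \<in> fibre E x; a \<in> carrier (A x); v \<in> fibre E y\<rbrakk>
          \<Longrightarrow> gact E x a u \<triangleleft>\<^bsub>E\<^esub> v = gact E (x \<triangleleft> y) (\<phi> x y a) (u \<triangleleft>\<^bsub>E\<^esub> v)"
    and X3: "\<lbrakk>x \<in> carrier X; y \<in> carrier X; u \<in> fibre E x; b \<in> carrier (A y); v \<in> fibre E y\<rbrakk>
          \<Longrightarrow> u \<triangleleft>\<^bsub>E\<^esub> gact E y b v = gact E (x \<triangleleft> y) (\<psi> y x b) (u \<triangleleft>\<^bsub>E\<^esub> v)"

locale quandle_extension = rack_extension + total: quandle E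

definition ext_equivalent ::
  "('x, 'r) rack_scheme \<Rightarrow> ('x \<Rightarrow> ('a, 'm) monoid_scheme)
    \<Rightarrow> ('d, 'x, 'a) extension \<Rightarrow> ('e, 'x, 'a) extension \<Rightarrow> bool" where
  "ext_equivalent X A D E \<longleftrightarrow>
     (\<exists>\<theta> \<in> rack_iso D E.
        (\<forall>u\<in>carrier D. proj E (\<theta> u) = proj D u) \<and>
        (\<forall>x\<in>carrier X. \<forall>a\<in>carrier (A x). \<forall>u\<in>fibre D x.
           \<theta> (gact D x a u) = gact E x a (\<theta> u)))"

text \<open>
  Extensions form a proper class; a set of them needs a bound on the type \<open>'e\<close> of their elements.
  Note that \<^const>\<open>ext_equivalent\<close> itself relates extensions living in different types.
\<close>

definition quandle_extensions ::
  "('x, 'r) rack_scheme \<Rightarrow> ('x \<Rightarrow> ('a, 'm) monoid_scheme)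
    \<Rightarrow> ('x \<Rightarrow> 'x \<Rightarrow> 'a \<Rightarrow> 'a) \<Rightarrow> ('x \<Rightarrow> 'x \<Rightarrow> 'a \<Rightarrow> 'a) \<Rightarrow> ('e, 'x, 'a) extension set" where
  "quandle_extensions X A \<phi> \<psi> = {E. quandle_extension X A \<phi> \<psi> E}"

definition ext_rel ::
  "('x, 'r) rack_scheme \<Rightarrow> ('x \<Rightarrow> ('a, 'm) monoid_scheme)
    \<Rightarrow> ('x \<Rightarrow> 'x \<Rightarrow> 'a \<Rightarrow> 'a) \<Rightarrow> ('x \<Rightarrow> 'x \<Rightarrow> 'a \<Rightarrow> 'a) \<Rightarrow> ('e, 'x, 'a) extension rel" where
  "ext_rel X A \<phi> \<psi> = {(D, E). D \<in> quandle_extensions X A \<phi> \<psi> \<and> E \<in> quandle_extensions X A \<phi> \<psi>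
     \<and> ext_equivalent X A D E}"

text \<open>The extension $E[\mathcal{A},\sigma]$; a family $\sigma$ is a function on pairs of indices.\<close>

definition factor_extension ::
  "('x, 'r) rack_scheme \<Rightarrow> ('x \<Rightarrow> ('a, 'm) monoid_scheme)
    \<Rightarrow> ('x \<Rightarrow> 'x \<Rightarrow> 'a \<Rightarrow> 'a) \<Rightarrow> ('x \<Rightarrow> 'x \<Rightarrow> 'a \<Rightarrow> 'a) \<Rightarrow> ('x \<times> 'x \<Rightarrow> 'a)
    \<Rightarrow> ('a \<times> 'x, 'x, 'a) extension" where
  "factor_extension X A \<phi> \<psi> \<sigma> =
     \<lparr>carrier = {(a, x). x \<in> carrier X \<and> a \<in> carrier (A x)},
      act = (\<lambda>(a, x) (b, y).
        (\<phi> x y a \<otimes>\<^bsub>A (x \<triangleleft>\<^bsub>X\<^esub> y)\<^esub> \<sigma> (x, y) \<otimes>\<^bsub>A (x \<triangleleft>\<^bsub>X\<^esub> y)\<^esub> \<psi> y x b, x \<triangleleft>\<^bsub>X\<^esub> y)),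
      proj = snd,
      gact = (\<lambda>x a. \<lambda>u \<in> carrier (A x) \<times> {x}. (a \<otimes>\<^bsub>A x\<^esub> fst u, x))\<rparr>"


section \<open>Factor sets and Ext\<close>

definition families ::
  "('x, 'r) rack_scheme \<Rightarrow> ('x \<Rightarrow> ('a, 'm) monoid_scheme) \<Rightarrow> ('x \<times> 'x \<Rightarrow> 'a) monoid" where
  "families X A = product_group (carrier X \<times> carrier X) (\<lambda>(x, y). A (x \<triangleleft>\<^bsub>X\<^esub> y))"

definition Z_Q ::
  "('x, 'r) rack_scheme \<Rightarrow> ('x \<Rightarrow> ('a, 'm) monoid_scheme)
    \<Rightarrow> ('x \<Rightarrow> 'x \<Rightarrow> 'a \<Rightarrow> 'a) \<Rightarrow> ('x \<Rightarrow> 'x \<Rightarrow> 'a \<Rightarrow> 'a) \<Rightarrow> ('x \<times> 'x \<Rightarrow> 'a) monoid" where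
  "Z_Q X A \<phi> \<psi> = (families X A)\<lparr>carrier := {\<sigma> \<in> carrier (families X A).
     (\<forall>x\<in>carrier X. \<sigma> (x, x) = \<one>\<^bsub>A x\<^esub>) \<and>
     (\<forall>x\<in>carrier X. \<forall>y\<in>carrier X. \<forall>z\<in>carrier X.
        let G = A ((x \<triangleleft>\<^bsub>X\<^esub> y) \<triangleleft>\<^bsub>X\<^esub> z) in
        \<sigma> (x \<triangleleft>\<^bsub>X\<^esub> y, z) \<otimes>\<^bsub>G\<^esub> \<phi> (x \<triangleleft>\<^bsub>X\<^esub> y) z (\<sigma> (x, y)) =
        \<phi> (x \<triangleleft>\<^bsub>X\<^esub> z) (y \<triangleleft>\<^bsub>X\<^esub> z) (\<sigma> (x, z))
          \<otimes>\<^bsub>G\<^esub> \<sigma> (x \<triangleleft>\<^bsub>X\<^esub> z, y \<triangleleft>\<^bsub>X\<^esub> z)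
          \<otimes>\<^bsub>G\<^esub> \<psi> (y \<triangleleft>\<^bsub>X\<^esub> z) (x \<triangleleft>\<^bsub>X\<^esub> z) (\<sigma> (y, z)))}\<rparr>"

definition B_Q ::
  "('x, 'r) rack_scheme \<Rightarrow> ('x \<Rightarrow> ('a, 'm) monoid_scheme)
    \<Rightarrow> ('x \<Rightarrow> 'x \<Rightarrow> 'a \<Rightarrow> 'a) \<Rightarrow> ('x \<Rightarrow> 'x \<Rightarrow> 'a \<Rightarrow> 'a) \<Rightarrow> ('x \<times> 'x \<Rightarrow> 'a) set" where
  "B_Q X A \<phi> \<psi> = {\<sigma> \<in> carrier (families X A).
     \<exists>\<upsilon>. (\<forall>x\<in>carrier X. \<upsilon> x \<in> carrier (A x)) \<and>
       (\<forall>x\<in>carrier X. \<forall>y\<in>carrier X.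
          let G = A (x \<triangleleft>\<^bsub>X\<^esub> y) in
          \<sigma> (x, y) = \<phi> x y (\<upsilon> x) \<otimes>\<^bsub>G\<^esub> inv\<^bsub>G\<^esub> \<upsilon> (x \<triangleleft>\<^bsub>X\<^esub> y) \<otimes>\<^bsub>G\<^esub> \<psi> y x (\<upsilon> y))}"

definition Ext_Q ::
  "('x, 'r) rack_scheme \<Rightarrow> ('x \<Rightarrow> ('a, 'm) monoid_scheme)
    \<Rightarrow> ('x \<Rightarrow> 'x \<Rightarrow> 'a \<Rightarrow> 'a) \<Rightarrow> ('x \<Rightarrow> 'x \<Rightarrow> 'a \<Rightarrow> 'a) \<Rightarrow> ('x \<times> 'x \<Rightarrow> 'a) set monoid" where
  "Ext_Q X A \<phi> \<psi> = Z_Q X A \<phi> \<psi> Mod B_Q X A \<phi> \<psi>"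

end

theory Submission
  imports Defs
begin

text \<open>
  The proof turns on choosing base points. Let \<open>E\<close> be an extension of \<open>X\<close>, and let \<open>s\<close> pick a point
  \<open>s x\<close> in each fibre. Since \<open>A (x \<triangleleft> y)\<close> acts simply transitively on the fibre over \<open>x \<triangleleft> y\<close>, there is
  exactly one family \<open>\<sigma>\<close> with \<open>s x \<triangleleft> s y = \<sigma> (x, y) \<cdot> s (x \<triangleleft> y)\<close>, and it measures how far \<open>s\<close> is from
  being a rack homomorphism. The choice of \<open>s\<close> identifies \<open>E\<close> with $E[\mathcal{A},\sigma]$ through
  \<open>(a, x) \<mapsto> a \<cdot> s x\<close>, and conversely an equivalence $E[\mathcal{A},\sigma] \to E$ carries the zero
  section \<open>x \<mapsto> (0, x)\<close> to such an \<open>s\<close>. So $E[\mathcal{A},\sigma]$ is equivalent to \<open>E\<close> exactly when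
  \<open>\<sigma>\<close> is the family of some section of \<open>E\<close> (\<open>equivalent_factor_extension_iff_section\<close>).

  Everything else is read off from this equivalence.

  \<^item> Every fibre is nonempty, so every \<open>E\<close> has a section. Evaluating idempotence and
    self-distributivity of \<open>E\<close> on the section, and cancelling the free action, gives precisely the
    two conditions that define a factor set (\<open>factor_set_if_section\<close>). Hence every quandle
    extension is equivalent to some $E[\mathcal{A},\sigma]$ with \<open>\<sigma>\<close> a factor set; and these are
    quandle extensions (\<open>quandle_extension_factor_extension\<close>).

  \<^item> A section of $E[\mathcal{A},\tau]$ is \<open>x \<mapsto> (\<upsilon> x, x)\<close> for a family \<open>\<upsilon>\<close>, and its family of
    deviations is \<open>\<tau>\<close> plus the coboundary of \<open>\<upsilon>\<close>. Hence $E[\mathcal{A},\sigma]$ and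
    $E[\mathcal{A},\tau]$ are equivalent iff \<open>\<sigma> - \<tau>\<close> is a coboundary
    (\<open>equivalent_factor_extensions_iff\<close>). In particular the coboundaries are the factor sets of
    extensions equivalent to $E[\mathcal{A},0]$. Therefore they are factor sets, and they form a
    subgroup because equivalence of extensions is an equivalence relation.

  Cosets of the coboundaries thus correspond to equivalence classes of extensions.
\<close>

section \<open>Families of elements of a module\<close>

context rack_module
begin

lemma group: "x \<in> carrier X \<Longrightarrow> group (A x)"
  using comm_group by (rule comm_group.axioms(2))

lemma phi_group_hom:
  "\<lbrakk>x \<in> carrier X; y \<in> carrier X\<rbrakk> \<Longrightarrow> group_hom (A x) (A (x \<triangleleft> y)) (\<phi> x y)"
  using phi_iso[of x y] by (auto simp: group_hom_def group_hom_axioms_def group act_closed iso_def)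

lemma psi_group_hom:
  "\<lbrakk>x \<in> carrier X; y \<in> carrier X\<rbrakk> \<Longrightarrow> group_hom (A y) (A (x \<triangleleft> y)) (\<psi> y x)"
  using psi_hom[of x y] by (auto simp: group_hom_def group_hom_axioms_def group act_closed)

lemmas phi_closed = group_hom.hom_closed[OF phi_group_hom]
  and phi_mult = group_hom.hom_mult[OF phi_group_hom]
  and phi_one = group_hom.hom_one[OF phi_group_hom]
  and psi_closed = group_hom.hom_closed[OF psi_group_hom]
  and psi_mult = group_hom.hom_mult[OF psi_group_hom]
  and psi_one = group_hom.hom_one[OF psi_group_hom]

lemma phi_bij: "\<lbrakk>x \<in> carrier X; y \<in> carrier X\<rbrakk>
    \<Longrightarrow> bij_betw (\<phi> x y) (carrier (A x)) (carrier (A (x \<triangleleft> y)))"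
  using phi_iso by (simp add: iso_def)

lemma carrier_families_iff:
  "\<sigma> \<in> carrier (families X A) \<longleftrightarrow> \<sigma> \<in> extensional (carrier X \<times> carrier X)
     \<and> (\<forall>x\<in>carrier X. \<forall>y\<in>carrier X. \<sigma> (x, y) \<in> carrier (A (x \<triangleleft> y)))"
  by (auto simp: families_def PiE_def Pi_def)

lemma families_closed:
  "\<lbrakk>\<sigma> \<in> carrier (families X A); x \<in> carrier X; y \<in> carrier X\<rbrakk>
    \<Longrightarrow> \<sigma> (x, y) \<in> carrier (A (x \<triangleleft> y))"
  by (simp add: carrier_families_iff)

lemma families_mult_apply:
  "\<lbrakk>x \<in> carrier X; y \<in> carrier X\<rbrakk>
    \<Longrightarrow> (\<sigma> \<otimes>\<^bsub>families X A\<^esub> \<tau>) (x, y) = \<sigma> (x, y) \<otimes>\<^bsub>A (x \<triangleleft> y)\<^esub> \<tau> (x, y)"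
  by (simp add: families_def)

lemma families_one_apply:
  "\<lbrakk>x \<in> carrier X; y \<in> carrier X\<rbrakk> \<Longrightarrow> \<one>\<^bsub>families X A\<^esub> (x, y) = \<one>\<^bsub>A (x \<triangleleft> y)\<^esub>"
  by (simp add: families_def)

lemma families_inv_apply:
  assumes "\<sigma> \<in> carrier (families X A)" "x \<in> carrier X" "y \<in> carrier X"
  shows "(inv\<^bsub>families X A\<^esub> \<sigma>) (x, y) = inv\<^bsub>A (x \<triangleleft> y)\<^esub> \<sigma> (x, y)"
proof -
  have "inv\<^bsub>families X A\<^esub> \<sigma>
      = (\<lambda>p \<in> carrier X \<times> carrier X. inv\<^bsub>(case p of (x, y) \<Rightarrow> A (x \<triangleleft> y))\<^esub> \<sigma> p)"
    unfolding families_def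
    by (rule inv_product_group) (use assms in \<open>auto simp: families_def group act_closed\<close>)
  then show ?thesis
    using assms by simp
qed

lemma families_group: "group (families X A)"
  unfolding families_def by (rule product_group) (auto simp: group act_closed)

lemma families_comm_group: "comm_group (families X A)"
proof (rule group.group_comm_groupI[OF families_group])
  fix \<sigma> \<tau> assume *: "\<sigma> \<in> carrier (families X A)" "\<tau> \<in> carrier (families X A)"
  interpret group "families X A" by (rule families_group)
  show "\<sigma> \<otimes>\<^bsub>families X A\<^esub> \<tau> = \<tau> \<otimes>\<^bsub>families X A\<^esub> \<sigma>"
  proof (rule extensionalityI[where A = "carrier X \<times> carrier X"])
    fix p assume "p \<in> carrier X \<times> carrier X"
    then obtain x y where p: "p = (x, y)" "x \<in> carrier X" "y \<in> carrier X" by blast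
    interpret comm_group "A (x \<triangleleft> y)" using p by (simp add: comm_group act_closed)
    show "(\<sigma> \<otimes>\<^bsub>families X A\<^esub> \<tau>) p = (\<tau> \<otimes>\<^bsub>families X A\<^esub> \<sigma>) p"
      using p * by (simp add: families_mult_apply families_closed m_comm)
  qed (use * m_closed carrier_families_iff in blast)+
qed

end


section \<open>Equivalence of extensions\<close>

context rack_extension
begin

lemma fibre_carrier: "u \<in> fibre E x \<Longrightarrow> u \<in> carrier E"
  by (simp add: fibre_def)

lemma fibre_proj: "u \<in> carrier E \<Longrightarrow> proj E u \<in> carrier X \<and> u \<in> fibre E (proj E u)"
  using proj_surj by (auto simp: fibre_def)

lemma act_fibre:
  "\<lbrakk>u \<in> fibre E x; v \<in> fibre E y\<rbrakk> \<Longrightarrow> u \<triangleleft>\<^bsub>E\<^esub> v \<in> fibre E (x \<triangleleft> y)"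
  using proj_hom by (auto simp: fibre_def rack_hom_def total.act_closed)

lemma gact_fibre:
  "\<lbrakk>x \<in> carrier X; a \<in> carrier (A x); u \<in> fibre E x\<rbrakk> \<Longrightarrow> gact E x a u \<in> fibre E x"
  using group_action.element_image[OF action] by blast

lemma gact_mult:
  "\<lbrakk>x \<in> carrier X; a \<in> carrier (A x); b \<in> carrier (A x); u \<in> fibre E x\<rbrakk>
    \<Longrightarrow> gact E x (a \<otimes>\<^bsub>A x\<^esub> b) u = gact E x a (gact E x b u)"
  using group_action.composition_rule[OF action] by blast

lemma gact_one:
  "\<lbrakk>x \<in> carrier X; u \<in> fibre E x\<rbrakk> \<Longrightarrow> gact E x \<one>\<^bsub>A x\<^esub> u = u"
  using group_action.id_eq_one[OF action] by (metis restrict_apply')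

lemma gact_free:
  "\<lbrakk>x \<in> carrier X; u \<in> fibre E x; a \<in> carrier (A x); b \<in> carrier (A x);
    gact E x a u = gact E x b u\<rbrakk> \<Longrightarrow> a = b"
  using X1[of x u "gact E x a u"] gact_fibre[of x a u] by metis

text \<open>
  The extension on the left must satisfy the axioms: the inverse map respects the operation and the
  actions only because \<open>E\<close> is closed under them.
\<close>

lemma ext_equivalent_sym:
  fixes F :: "('f, 'x, 'a) extension"
  assumes "ext_equivalent X A E F"
  shows "ext_equivalent X A F E"
proof -
  obtain \<theta> where hom: "\<theta> \<in> rack_hom E F" and bij: "bij_betw \<theta> (carrier E) (carrier F)"
    and proj: "\<And>u. u \<in> carrier E \<Longrightarrow> proj F (\<theta> u) = proj E u"
    and equivar: "\<And>x a u. \<lbrakk>x \<in> carrier X; a \<in> carrier (A x); u \<in> fibre E x\<rbrakk>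
        \<Longrightarrow> \<theta> (gact E x a u) = gact F x a (\<theta> u)"
    using assms unfolding ext_equivalent_def rack_iso_def by blast
  define \<eta> where "\<eta> = inv_into (carrier E) \<theta>"
  have \<eta>_in: "\<eta> v \<in> carrier E" and \<theta>\<eta>: "\<theta> (\<eta> v) = v" if "v \<in> carrier F" for v
    using bij that
    by (auto simp: \<eta>_def bij_betw_def inv_into_into f_inv_into_f)
  have \<eta>\<theta>: "\<eta> (\<theta> u) = u" if "u \<in> carrier E" for u
    using bij that by (simp add: \<eta>_def bij_betw_def)
  have "\<eta> (v \<triangleleft>\<^bsub>F\<^esub> w) = \<eta> v \<triangleleft>\<^bsub>E\<^esub> \<eta> w" if "v \<in> carrier F" "w \<in> carrier F" for v w
  proof -
    have "\<theta> (\<eta> v \<triangleleft>\<^bsub>E\<^esub> \<eta> w) = v \<triangleleft>\<^bsub>F\<^esub> w"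
      using hom that by (simp add: rack_hom_def \<eta>_in \<theta>\<eta>)
    then show ?thesis
      using \<eta>\<theta>[of "\<eta> v \<triangleleft>\<^bsub>E\<^esub> \<eta> w"] that by (simp add: total.act_closed \<eta>_in)
  qed
  then have "\<eta> \<in> rack_iso F E"
    using bij_betw_inv_into[OF bij] by (auto simp: rack_iso_def rack_hom_def \<eta>_in \<eta>_def[symmetric])
  moreover have proj_\<eta>: "proj E (\<eta> v) = proj F v" if "v \<in> carrier F" for v
    using that proj[of "\<eta> v"] by (simp add: \<eta>_in \<theta>\<eta>)
  moreover have "\<eta> (gact F x a v) = gact E x a (\<eta> v)"
    if "x \<in> carrier X" "a \<in> carrier (A x)" "v \<in> fibre F x" for x a v
  proof -
    have v: "v \<in> carrier F" and \<eta>v: "\<eta> v \<in> fibre E x"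
      using that by (auto simp: fibre_def \<eta>_in proj_\<eta>)
    have "\<theta> (gact E x a (\<eta> v)) = gact F x a v"
      using equivar[OF that(1,2) \<eta>v] v by (simp add: \<theta>\<eta>)
    then show ?thesis
      using \<eta>\<theta> gact_fibre[OF that(1,2) \<eta>v] fibre_carrier by metis
  qed
  ultimately show ?thesis
    unfolding ext_equivalent_def by blast
qed

end

lemma ext_equivalent_refl: "ext_equivalent X A E E"
  unfolding ext_equivalent_def
  by (rule bexI[where x = id]) (auto simp: rack_iso_def rack_hom_def)

lemma ext_equivalent_trans:
  assumes "ext_equivalent X A D E" and "ext_equivalent X A E F"
  shows "ext_equivalent X A D F"
proof -
  obtain \<theta> where \<theta>: "\<theta> \<in> rack_hom D E" "bij_betw \<theta> (carrier D) (carrier E)"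
    "\<And>u. u \<in> carrier D \<Longrightarrow> proj E (\<theta> u) = proj D u"
    "\<And>x a u. \<lbrakk>x \<in> carrier X; a \<in> carrier (A x); u \<in> fibre D x\<rbrakk>
        \<Longrightarrow> \<theta> (gact D x a u) = gact E x a (\<theta> u)"
    using assms(1) unfolding ext_equivalent_def rack_iso_def by blast
  obtain \<eta> where \<eta>: "\<eta> \<in> rack_hom E F" "bij_betw \<eta> (carrier E) (carrier F)"
    "\<And>u. u \<in> carrier E \<Longrightarrow> proj F (\<eta> u) = proj E u"
    "\<And>x a u. \<lbrakk>x \<in> carrier X; a \<in> carrier (A x); u \<in> fibre E x\<rbrakk>
        \<Longrightarrow> \<eta> (gact E x a u) = gact F x a (\<eta> u)"
    using assms(2) unfolding ext_equivalent_def rack_iso_def by blast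
  have in_E: "\<theta> u \<in> carrier E" if "u \<in> carrier D" for u
    using \<theta>(1) that by (auto simp: rack_hom_def)
  have fib: "\<theta> u \<in> fibre E x" if "u \<in> fibre D x" for u x
    using that by (auto simp: fibre_def in_E \<theta>(3))
  have "\<eta> \<circ> \<theta> \<in> rack_iso D F"
    using \<theta>(1) \<eta>(1) bij_betw_trans[OF \<theta>(2) \<eta>(2)] by (auto simp: rack_iso_def rack_hom_def in_E)
  then show ?thesis
    unfolding ext_equivalent_def
    by (rule bexI[rotated]) (auto simp: in_E fib \<theta>(3,4) \<eta>(3,4))
qed

lemma equiv_ext_rel: "equiv (quandle_extensions X A \<phi> \<psi>) (ext_rel X A \<phi> \<psi>)"
proof (rule equivI)
  show "refl_on (quandle_extensions X A \<phi> \<psi>) (ext_rel X A \<phi> \<psi>)"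
    by (auto simp: refl_on_def ext_rel_def ext_equivalent_refl)
  show "sym (ext_rel X A \<phi> \<psi>)"
    by (auto simp: sym_def ext_rel_def quandle_extensions_def quandle_extension_def
        intro: rack_extension.ext_equivalent_sym)
  show "trans (ext_rel X A \<phi> \<psi>)"
    by (auto simp: trans_def ext_rel_def intro: ext_equivalent_trans)
qed (auto simp: ext_rel_def)


section \<open>Sections\<close>

text \<open>
  A choice of base points, one in each fibre, whose failure to be a homomorphism is \<open>\<sigma>\<close>.
\<close>

definition (in rack_extension) section_with :: "('x \<times> 'x \<Rightarrow> 'a) \<Rightarrow> ('x \<Rightarrow> 'e) \<Rightarrow> bool" where
  "section_with \<sigma> s \<longleftrightarrow> (\<forall>x\<in>carrier X. s x \<in> fibre E x) \<and>
     (\<forall>x\<in>carrier X. \<forall>y\<in>carrier X. s x \<triangleleft>\<^bsub>E\<^esub> s y = gact E (x \<triangleleft> y) (\<sigma> (x, y)) (s (x \<triangleleft> y)))"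

context rack_module
begin

lemma fibre_factor_extension:
  "x \<in> carrier X \<Longrightarrow> fibre (factor_extension X A \<phi> \<psi> \<sigma>) x = carrier (A x) \<times> {x}"
  by (auto simp: fibre_def factor_extension_def)

lemma carrier_factor_extension:
  "(a, x) \<in> carrier (factor_extension X A \<phi> \<psi> \<sigma>) \<longleftrightarrow> x \<in> carrier X \<and> a \<in> carrier (A x)"
  by (simp add: factor_extension_def)

lemma act_factor_extension:
  "(a, x) \<triangleleft>\<^bsub>factor_extension X A \<phi> \<psi> \<sigma>\<^esub> (b, y) =
     (\<phi> x y a \<otimes>\<^bsub>A (x \<triangleleft> y)\<^esub> \<sigma> (x, y) \<otimes>\<^bsub>A (x \<triangleleft> y)\<^esub> \<psi> y x b, x \<triangleleft> y)"
  by (simp add: factor_extension_def)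

lemma gact_factor_extension:
  "b \<in> carrier (A x) \<Longrightarrow> gact (factor_extension X A \<phi> \<psi> \<sigma>) x a (b, x) = (a \<otimes>\<^bsub>A x\<^esub> b, x)"
  by (simp add: factor_extension_def)

lemma proj_factor_extension: "proj (factor_extension X A \<phi> \<psi> \<sigma>) = snd"
  by (simp add: factor_extension_def)

end

context rack_extension
begin

text \<open>
  The equivalence is \<open>(a, x) \<mapsto> a \<cdot> s x\<close>. It is bijective because the actions are simply transitive,
  and by (X2) and (X3) it turns \<open>(a \<cdot> s x) \<triangleleft> (b \<cdot> s y)\<close> into the operation of
  $E[\mathcal{A},\sigma]$.
\<close>

lemma equivalent_factor_extension_if_section:
  assumes \<sigma>: "\<sigma> \<in> carrier (families X A)" and "section_with \<sigma> s"
  shows "ext_equivalent X A (factor_extension X A \<phi> \<psi> \<sigma>) E"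
proof -
  let ?F = "factor_extension X A \<phi> \<psi> \<sigma>"
  have s: "s x \<in> fibre E x" if "x \<in> carrier X" for x
    using assms(2) that by (simp add: section_with_def)
  have act_s: "s x \<triangleleft>\<^bsub>E\<^esub> s y = gact E (x \<triangleleft> y) (\<sigma> (x, y)) (s (x \<triangleleft> y))"
    if "x \<in> carrier X" "y \<in> carrier X" for x y
    using assms(2) that by (simp add: section_with_def)
  define \<theta> where "\<theta> = (\<lambda>(a, x). gact E x a (s x))"
  have \<theta>_fibre: "\<theta> (a, x) \<in> fibre E x" if "x \<in> carrier X" "a \<in> carrier (A x)" for a x
    using that by (simp add: \<theta>_def gact_fibre s)
  have hom: "\<theta> ((a, x) \<triangleleft>\<^bsub>?F\<^esub> (b, y)) = \<theta> (a, x) \<triangleleft>\<^bsub>E\<^esub> \<theta> (b, y)"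
    if "x \<in> carrier X" "a \<in> carrier (A x)" "y \<in> carrier X" "b \<in> carrier (A y)" for a x b y
  proof -
    let ?z = "x \<triangleleft> y"
    interpret G: comm_group "A ?z" using that by (simp add: comm_group act_closed)
    have z: "?z \<in> carrier X" using that by (simp add: act_closed)
    have cl: "\<phi> x y a \<in> carrier (A ?z)" "\<sigma> (x, y) \<in> carrier (A ?z)" "\<psi> y x b \<in> carrier (A ?z)"
      using that \<sigma> by (auto simp: phi_closed psi_closed families_closed)
    have "\<theta> (a, x) \<triangleleft>\<^bsub>E\<^esub> \<theta> (b, y) = gact E ?z (\<psi> y x b) (gact E ?z (\<phi> x y a) (s x \<triangleleft>\<^bsub>E\<^esub> s y))"
      using that by (simp add: \<theta>_def X2 X3 gact_fibre s)
    also have "\<dots> = gact E ?z (\<psi> y x b \<otimes>\<^bsub>A ?z\<^esub> (\<phi> x y a \<otimes>\<^bsub>A ?z\<^esub> \<sigma> (x, y))) (s ?z)"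
      using that z cl by (simp add: act_s gact_mult gact_fibre s)
    also have "\<psi> y x b \<otimes>\<^bsub>A ?z\<^esub> (\<phi> x y a \<otimes>\<^bsub>A ?z\<^esub> \<sigma> (x, y))
        = \<phi> x y a \<otimes>\<^bsub>A ?z\<^esub> \<sigma> (x, y) \<otimes>\<^bsub>A ?z\<^esub> \<psi> y x b"
      using cl by (simp add: G.m_ac)
    finally show ?thesis
      by (simp add: act_factor_extension \<theta>_def)
  qed
  have equivar: "\<theta> (gact ?F x a (b, x)) = gact E x a (\<theta> (b, x))"
    if "x \<in> carrier X" "a \<in> carrier (A x)" "b \<in> carrier (A x)" for a b x
    using that by (simp add: gact_factor_extension \<theta>_def gact_mult s)
  have "inj_on \<theta> (carrier ?F)"
  proof (rule inj_onI, clarify)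
    fix a x b y
    assume *: "(a, x) \<in> carrier ?F" "(b, y) \<in> carrier ?F" "\<theta> (a, x) = \<theta> (b, y)"
    then have "x = y"
      using \<theta>_fibre[of x a] \<theta>_fibre[of y b] by (simp add: carrier_factor_extension fibre_def)
    with * show "a = b \<and> x = y"
      using gact_free[of x "s x" a b] by (simp add: carrier_factor_extension \<theta>_def s)
  qed
  moreover have "\<theta> ` carrier ?F = carrier E"
  proof
    show "\<theta> ` carrier ?F \<subseteq> carrier E"
      using fibre_carrier[OF \<theta>_fibre] by (auto simp: carrier_factor_extension)
    show "carrier E \<subseteq> \<theta> ` carrier ?F"
    proof
      fix u assume "u \<in> carrier E"
      then have x: "proj E u \<in> carrier X" and u: "u \<in> fibre E (proj E u)"
        using fibre_proj by auto
      obtain a where "a \<in> carrier (A (proj E u))" "gact E (proj E u) a (s (proj E u)) = u"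
        using X1[OF x s[OF x] u] by blast
      then show "u \<in> \<theta> ` carrier ?F"
        using x by (intro image_eqI[where x = "(a, proj E u)"])
          (simp_all add: carrier_factor_extension \<theta>_def)
    qed
  qed
  ultimately have "\<theta> \<in> rack_iso ?F E"
    using hom by (auto simp: rack_iso_def rack_hom_def bij_betw_def carrier_factor_extension)
  then show ?thesis
    unfolding ext_equivalent_def
    by (rule bexI[rotated])
      (use \<theta>_fibre in \<open>auto simp: carrier_factor_extension fibre_factor_extension equivar
         proj_factor_extension fibre_def\<close>)
qed

text \<open>
  The section is the image of \<open>x \<mapsto> (0, x)\<close>: in $E[\mathcal{A},\sigma]$ the product of \<open>(0, x)\<close> and
  \<open>(0, y)\<close> is \<open>(\<sigma> (x, y), x \<triangleleft> y)\<close>, which is \<open>(0, x \<triangleleft> y)\<close> translated by \<open>\<sigma> (x, y)\<close>.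
\<close>

lemma section_if_equivalent_factor_extension:
  assumes \<sigma>: "\<sigma> \<in> carrier (families X A)"
    and "ext_equivalent X A (factor_extension X A \<phi> \<psi> \<sigma>) E"
  shows "\<exists>s. section_with \<sigma> s"
proof -
  let ?F = "factor_extension X A \<phi> \<psi> \<sigma>"
  obtain \<theta> where hom: "\<theta> \<in> rack_hom ?F E"
    and proj: "\<And>u. u \<in> carrier ?F \<Longrightarrow> proj E (\<theta> u) = snd u"
    and equivar: "\<And>x a u. \<lbrakk>x \<in> carrier X; a \<in> carrier (A x); u \<in> fibre ?F x\<rbrakk>
        \<Longrightarrow> \<theta> (gact ?F x a u) = gact E x a (\<theta> u)"
    using assms(2) unfolding ext_equivalent_def rack_iso_def proj_factor_extension by blast
  define s where "s x = \<theta> (\<one>\<^bsub>A x\<^esub>, x)" for x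
  have zero: "(\<one>\<^bsub>A x\<^esub>, x) \<in> carrier ?F" if "x \<in> carrier X" for x
    using that group[OF that] by (simp add: carrier_factor_extension group.is_monoid)
  have "s x \<in> fibre E x" if "x \<in> carrier X" for x
    using zero[OF that] hom proj by (auto simp: fibre_def s_def rack_hom_def)
  moreover have "s x \<triangleleft>\<^bsub>E\<^esub> s y = gact E (x \<triangleleft> y) (\<sigma> (x, y)) (s (x \<triangleleft> y))"
    if xy: "x \<in> carrier X" "y \<in> carrier X" for x y
  proof -
    have z: "x \<triangleleft> y \<in> carrier X" using xy by (simp add: act_closed)
    interpret G: group "A (x \<triangleleft> y)" using z by (rule group)
    have \<sigma>xy: "\<sigma> (x, y) \<in> carrier (A (x \<triangleleft> y))" using \<sigma> xy by (rule families_closed)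
    have "s x \<triangleleft>\<^bsub>E\<^esub> s y = \<theta> ((\<one>\<^bsub>A x\<^esub>, x) \<triangleleft>\<^bsub>?F\<^esub> (\<one>\<^bsub>A y\<^esub>, y))"
      using hom zero xy by (simp add: s_def rack_hom_def)
    also have "(\<one>\<^bsub>A x\<^esub>, x) \<triangleleft>\<^bsub>?F\<^esub> (\<one>\<^bsub>A y\<^esub>, y) = gact ?F (x \<triangleleft> y) (\<sigma> (x, y)) (\<one>\<^bsub>A (x \<triangleleft> y)\<^esub>, x \<triangleleft> y)"
      using xy \<sigma>xy by (simp add: act_factor_extension gact_factor_extension phi_one psi_one)
    also have "\<theta> \<dots> = gact E (x \<triangleleft> y) (\<sigma> (x, y)) (s (x \<triangleleft> y))"
      using z \<sigma>xy by (simp add: equivar fibre_factor_extension s_def)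
    finally show ?thesis .
  qed
  ultimately show ?thesis
    unfolding section_with_def by blast
qed

theorem equivalent_factor_extension_iff_section:
  assumes "\<sigma> \<in> carrier (families X A)"
  shows "ext_equivalent X A (factor_extension X A \<phi> \<psi> \<sigma>) E \<longleftrightarrow> (\<exists>s. section_with \<sigma> s)"
  using assms equivalent_factor_extension_if_section section_if_equivalent_factor_extension by blast

text \<open>
  The projection is onto, so base points can be chosen, and transitivity of the actions (X1)
  then supplies the family.
\<close>

lemma exists_section: "\<exists>\<sigma>\<in>carrier (families X A). \<exists>s. section_with \<sigma> s"
proof -
  have "\<exists>u. u \<in> fibre E x" if "x \<in> carrier X" for x
  proof -
    from that obtain u where "u \<in> carrier E" "proj E u = x"
      using proj_surj by (metis imageE)
    then show ?thesis by (auto simp: fibre_def)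
  qed
  then obtain s where s: "\<And>x. x \<in> carrier X \<Longrightarrow> s x \<in> fibre E x"
    by metis
  have "\<exists>a. a \<in> carrier (A (x \<triangleleft> y)) \<and> gact E (x \<triangleleft> y) a (s (x \<triangleleft> y)) = s x \<triangleleft>\<^bsub>E\<^esub> s y"
    if "x \<in> carrier X" "y \<in> carrier X" for x y
    using that X1 by (metis act_closed act_fibre s)
  then obtain f where f: "\<And>x y. \<lbrakk>x \<in> carrier X; y \<in> carrier X\<rbrakk> \<Longrightarrow>
      f x y \<in> carrier (A (x \<triangleleft> y)) \<and> gact E (x \<triangleleft> y) (f x y) (s (x \<triangleleft> y)) = s x \<triangleleft>\<^bsub>E\<^esub> s y"
    by metis
  have "(\<lambda>(x, y)\<in>carrier X \<times> carrier X. f x y) \<in> carrier (families X A)"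
    using f by (auto simp: carrier_families_iff)
  moreover have "section_with (\<lambda>(x, y)\<in>carrier X \<times> carrier X. f x y) s"
    using f s by (auto simp: section_with_def)
  ultimately show ?thesis by blast
qed

end


section \<open>Factor sets\<close>

context rack_module
begin

lemma carrier_Z_Q_iff:
  "\<sigma> \<in> carrier (Z_Q X A \<phi> \<psi>) \<longleftrightarrow> \<sigma> \<in> carrier (families X A) \<and>
     (\<forall>x\<in>carrier X. \<sigma> (x, x) = \<one>\<^bsub>A x\<^esub>) \<and>
     (\<forall>x\<in>carrier X. \<forall>y\<in>carrier X. \<forall>z\<in>carrier X.
        \<sigma> (x \<triangleleft> y, z) \<otimes>\<^bsub>A ((x \<triangleleft> y) \<triangleleft> z)\<^esub> \<phi> (x \<triangleleft> y) z (\<sigma> (x, y)) =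
        \<phi> (x \<triangleleft> z) (y \<triangleleft> z) (\<sigma> (x, z)) \<otimes>\<^bsub>A ((x \<triangleleft> y) \<triangleleft> z)\<^esub> \<sigma> (x \<triangleleft> z, y \<triangleleft> z)
          \<otimes>\<^bsub>A ((x \<triangleleft> y) \<triangleleft> z)\<^esub> \<psi> (y \<triangleleft> z) (x \<triangleleft> z) (\<sigma> (y, z)))"
  by (simp add: Z_Q_def Let_def)

lemma B_Q_iff:
  "\<sigma> \<in> B_Q X A \<phi> \<psi> \<longleftrightarrow> \<sigma> \<in> carrier (families X A) \<and>
     (\<exists>\<upsilon>. (\<forall>x\<in>carrier X. \<upsilon> x \<in> carrier (A x)) \<and>
       (\<forall>x\<in>carrier X. \<forall>y\<in>carrier X. \<sigma> (x, y) =
          \<phi> x y (\<upsilon> x) \<otimes>\<^bsub>A (x \<triangleleft> y)\<^esub> inv\<^bsub>A (x \<triangleleft> y)\<^esub> \<upsilon> (x \<triangleleft> y)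
            \<otimes>\<^bsub>A (x \<triangleleft> y)\<^esub> \<psi> y x (\<upsilon> y)))"
  by (simp add: B_Q_def Let_def)

text \<open>
  All terms of the cocycle condition lie in one group, although some of them are indexed by
  \<open>(x \<triangleleft> z) \<triangleleft> (y \<triangleleft> z)\<close>, which equals \<open>(x \<triangleleft> y) \<triangleleft> z\<close> only by self-distributivity.
\<close>

lemma cocycle_terms_closed:
  assumes "\<sigma> \<in> carrier (families X A)" "x \<in> carrier X" "y \<in> carrier X" "z \<in> carrier X"
  shows "\<sigma> (x \<triangleleft> y, z) \<in> carrier (A ((x \<triangleleft> y) \<triangleleft> z))"
    and "\<phi> (x \<triangleleft> y) z (\<sigma> (x, y)) \<in> carrier (A ((x \<triangleleft> y) \<triangleleft> z))"
    and "\<phi> (x \<triangleleft> z) (y \<triangleleft> z) (\<sigma> (x, z)) \<in> carrier (A ((x \<triangleleft> y) \<triangleleft> z))"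
    and "\<sigma> (x \<triangleleft> z, y \<triangleleft> z) \<in> carrier (A ((x \<triangleleft> y) \<triangleleft> z))"
    and "\<psi> (y \<triangleleft> z) (x \<triangleleft> z) (\<sigma> (y, z)) \<in> carrier (A ((x \<triangleleft> y) \<triangleleft> z))"
proof -
  note X = act_closed[OF assms(2,3)] act_closed[OF assms(2,4)] act_closed[OF assms(3,4)]
  note distrib = act_distrib[OF assms(2-4), symmetric]
  note \<sigma> = families_closed[OF assms(1)]
  show "\<sigma> (x \<triangleleft> y, z) \<in> carrier (A ((x \<triangleleft> y) \<triangleleft> z))"
    and "\<phi> (x \<triangleleft> y) z (\<sigma> (x, y)) \<in> carrier (A ((x \<triangleleft> y) \<triangleleft> z))"
    using assms X \<sigma> by (auto intro: phi_closed)
  show "\<phi> (x \<triangleleft> z) (y \<triangleleft> z) (\<sigma> (x, z)) \<in> carrier (A ((x \<triangleleft> y) \<triangleleft> z))"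
    using phi_closed[OF X(2,3)] \<sigma>[OF assms(2,4)] unfolding distrib .
  show "\<sigma> (x \<triangleleft> z, y \<triangleleft> z) \<in> carrier (A ((x \<triangleleft> y) \<triangleleft> z))"
    using \<sigma>[OF X(2,3)] unfolding distrib .
  show "\<psi> (y \<triangleleft> z) (x \<triangleleft> z) (\<sigma> (y, z)) \<in> carrier (A ((x \<triangleleft> y) \<triangleleft> z))"
    using psi_closed[OF X(2,3)] \<sigma>[OF assms(3,4)] unfolding distrib .
qed

end

text \<open>
  The cocycle condition as it enters self-distributivity of $E[\mathcal{A},\sigma]$: both sides of
  that law consist of the terms \<open>a\<close>, \<open>b\<close>, \<open>c\<close>, \<open>d\<close> coming from the three elements, and of the terms
  of one side of the cocycle condition.
\<close>

lemma (in comm_group) cocycle_shuffle: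
  assumes "t \<otimes> s = u \<otimes> v \<otimes> w"
    and "a \<in> carrier G" "b \<in> carrier G" "c \<in> carrier G" "d \<in> carrier G"
    and "s \<in> carrier G" "t \<in> carrier G" "u \<in> carrier G" "v \<in> carrier G" "w \<in> carrier G"
  shows "a \<otimes> s \<otimes> b \<otimes> t \<otimes> (c \<otimes> d) = a \<otimes> u \<otimes> c \<otimes> v \<otimes> (b \<otimes> w \<otimes> d)"
proof -
  have "a \<otimes> s \<otimes> b \<otimes> t \<otimes> (c \<otimes> d) = a \<otimes> b \<otimes> c \<otimes> d \<otimes> (t \<otimes> s)"
    using assms(2-) by (simp add: m_ac)
  also have "\<dots> = a \<otimes> u \<otimes> c \<otimes> v \<otimes> (b \<otimes> w \<otimes> d)"
    unfolding assms(1) using assms(2-) by (simp add: m_ac)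
  finally show ?thesis .
qed

text \<open>
  The quandle laws of \<open>E\<close>, evaluated at the base points, say that two translates of one base point
  coincide; as the action is free, the translating group elements are equal. Idempotence gives the
  normalisation and self-distributivity gives the cocycle condition.
\<close>

lemma (in quandle_extension) factor_set_if_section:
  assumes \<sigma>: "\<sigma> \<in> carrier (families X A)" and sec: "section_with \<sigma> s"
  shows "\<sigma> \<in> carrier (Z_Q X A \<phi> \<psi>)"
proof -
  have s: "s x \<in> fibre E x" if "x \<in> carrier X" for x
    using sec that by (simp add: section_with_def)
  have act_s: "s x \<triangleleft>\<^bsub>E\<^esub> s y = gact E (x \<triangleleft> y) (\<sigma> (x, y)) (s (x \<triangleleft> y))"
    if "x \<in> carrier X" "y \<in> carrier X" for x y
    using sec that by (simp add: section_with_def)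
  \<comment> \<open>\<open>X\<close> inherits idempotence from \<open>E\<close> through the projection\<close>
  have idem: "x \<triangleleft> x = x" if "x \<in> carrier X" for x
  proof -
    have "s x \<triangleleft>\<^bsub>E\<^esub> s x = s x"
      using s[OF that] by (intro total.act_idem) (rule fibre_carrier)
    then show ?thesis
      using act_fibre[OF s[OF that] s[OF that]] s[OF that] by (simp add: fibre_def)
  qed
  have "\<sigma> (x, x) = \<one>\<^bsub>A x\<^esub>" if x: "x \<in> carrier X" for x
  proof (rule gact_free[OF x s[OF x]])
    have "s x \<triangleleft>\<^bsub>E\<^esub> s x = s x"
      using s[OF x] by (intro total.act_idem) (rule fibre_carrier)
    then show "gact E x (\<sigma> (x, x)) (s x) = gact E x \<one>\<^bsub>A x\<^esub> (s x)"
      using act_s[OF x x] x by (simp add: idem gact_one s)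
    show "\<sigma> (x, x) \<in> carrier (A x)"
      using families_closed[OF \<sigma> x x] by (simp add: idem x)
    show "\<one>\<^bsub>A x\<^esub> \<in> carrier (A x)"
      using group[OF x] by (simp add: group.is_monoid)
  qed
  moreover have "\<sigma> (x \<triangleleft> y, z) \<otimes>\<^bsub>A ((x \<triangleleft> y) \<triangleleft> z)\<^esub> \<phi> (x \<triangleleft> y) z (\<sigma> (x, y)) =
      \<phi> (x \<triangleleft> z) (y \<triangleleft> z) (\<sigma> (x, z)) \<otimes>\<^bsub>A ((x \<triangleleft> y) \<triangleleft> z)\<^esub> \<sigma> (x \<triangleleft> z, y \<triangleleft> z)
        \<otimes>\<^bsub>A ((x \<triangleleft> y) \<triangleleft> z)\<^esub> \<psi> (y \<triangleleft> z) (x \<triangleleft> z) (\<sigma> (y, z))"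
    if x: "x \<in> carrier X" and y: "y \<in> carrier X" and z: "z \<in> carrier X" for x y z
  proof -
    define w where "w = (x \<triangleleft> y) \<triangleleft> z"
    have w: "w \<in> carrier X" using x y z by (simp add: w_def act_closed)
    have w': "(x \<triangleleft> z) \<triangleleft> (y \<triangleleft> z) = w" using act_distrib[OF x y z] by (simp add: w_def)
    interpret G: comm_group "A w" using w by (rule comm_group)
    note cl = cocycle_terms_closed[OF \<sigma> x y z, folded w_def]
    have X: "x \<triangleleft> y \<in> carrier X" "x \<triangleleft> z \<in> carrier X" "y \<triangleleft> z \<in> carrier X"
      using x y z by (auto simp: act_closed)
    note \<sigma>cl = families_closed[OF \<sigma>]
    have "(s x \<triangleleft>\<^bsub>E\<^esub> s y) \<triangleleft>\<^bsub>E\<^esub> s z = gact E (x \<triangleleft> y) (\<sigma> (x, y)) (s (x \<triangleleft> y)) \<triangleleft>\<^bsub>E\<^esub> s z"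
      by (simp add: act_s x y)
    also have "\<dots> = gact E w (\<phi> (x \<triangleleft> y) z (\<sigma> (x, y))) (gact E w (\<sigma> (x \<triangleleft> y, z)) (s w))"
      using X2[OF X(1) z s[OF X(1)] \<sigma>cl[OF x y] s[OF z]] act_s[OF X(1) z]
      by (simp add: w_def)
    also have "\<dots> = gact E w (\<phi> (x \<triangleleft> y) z (\<sigma> (x, y)) \<otimes>\<^bsub>A w\<^esub> \<sigma> (x \<triangleleft> y, z)) (s w)"
      using cl w by (simp add: gact_mult s)
    finally have L: "(s x \<triangleleft>\<^bsub>E\<^esub> s y) \<triangleleft>\<^bsub>E\<^esub> s z = \<dots>" .
    have "(s x \<triangleleft>\<^bsub>E\<^esub> s z) \<triangleleft>\<^bsub>E\<^esub> (s y \<triangleleft>\<^bsub>E\<^esub> s z) =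
        gact E (x \<triangleleft> z) (\<sigma> (x, z)) (s (x \<triangleleft> z)) \<triangleleft>\<^bsub>E\<^esub> gact E (y \<triangleleft> z) (\<sigma> (y, z)) (s (y \<triangleleft> z))"
      by (simp add: act_s x y z)
    also have "\<dots> = gact E w (\<phi> (x \<triangleleft> z) (y \<triangleleft> z) (\<sigma> (x, z)))
        (s (x \<triangleleft> z) \<triangleleft>\<^bsub>E\<^esub> gact E (y \<triangleleft> z) (\<sigma> (y, z)) (s (y \<triangleleft> z)))"
      using X2[OF X(2,3) s[OF X(2)] \<sigma>cl[OF x z]] gact_fibre[OF X(3) \<sigma>cl[OF y z] s[OF X(3)]]
      by (simp add: w')
    also have "s (x \<triangleleft> z) \<triangleleft>\<^bsub>E\<^esub> gact E (y \<triangleleft> z) (\<sigma> (y, z)) (s (y \<triangleleft> z))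
        = gact E w (\<psi> (y \<triangleleft> z) (x \<triangleleft> z) (\<sigma> (y, z))) (gact E w (\<sigma> (x \<triangleleft> z, y \<triangleleft> z)) (s w))"
      using X3[OF X(2,3) s[OF X(2)] \<sigma>cl[OF y z] s[OF X(3)]] act_s[OF X(2,3)]
      by (simp add: w')
    also have "gact E w (\<phi> (x \<triangleleft> z) (y \<triangleleft> z) (\<sigma> (x, z))) \<dots>
        = gact E w (\<phi> (x \<triangleleft> z) (y \<triangleleft> z) (\<sigma> (x, z)) \<otimes>\<^bsub>A w\<^esub>
            (\<psi> (y \<triangleleft> z) (x \<triangleleft> z) (\<sigma> (y, z)) \<otimes>\<^bsub>A w\<^esub> \<sigma> (x \<triangleleft> z, y \<triangleleft> z))) (s w)"
      using cl w by (simp add: gact_mult gact_fibre s)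
    finally have R: "(s x \<triangleleft>\<^bsub>E\<^esub> s z) \<triangleleft>\<^bsub>E\<^esub> (s y \<triangleleft>\<^bsub>E\<^esub> s z) = \<dots>" .
    have "(s x \<triangleleft>\<^bsub>E\<^esub> s y) \<triangleleft>\<^bsub>E\<^esub> s z = (s x \<triangleleft>\<^bsub>E\<^esub> s z) \<triangleleft>\<^bsub>E\<^esub> (s y \<triangleleft>\<^bsub>E\<^esub> s z)"
      using s x y z fibre_carrier by (intro total.act_distrib) blast+
    then have "\<phi> (x \<triangleleft> y) z (\<sigma> (x, y)) \<otimes>\<^bsub>A w\<^esub> \<sigma> (x \<triangleleft> y, z)
        = \<phi> (x \<triangleleft> z) (y \<triangleleft> z) (\<sigma> (x, z)) \<otimes>\<^bsub>A w\<^esub>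
            (\<psi> (y \<triangleleft> z) (x \<triangleleft> z) (\<sigma> (y, z)) \<otimes>\<^bsub>A w\<^esub> \<sigma> (x \<triangleleft> z, y \<triangleleft> z))"
      unfolding L R using cl by (intro gact_free[OF w s[OF w]]) auto
    then show ?thesis
      using cl by (simp add: G.m_ac flip: w_def)
  qed
  ultimately show ?thesis
    using \<sigma> by (simp add: carrier_Z_Q_iff)
qed

context quandle_module
begin

text \<open>
  Right translation by \<open>(b, y)\<close> is invertible because it is so on \<open>X\<close> and each \<open>\<phi> w y\<close> is bijective.
  In self-distributivity, the terms involving the three given elements match by the module
  axioms, and the others by the cocycle condition. Idempotence is
  the quandle axiom of the module together with \<open>\<sigma> (x, x) = 0\<close>.
\<close>

lemma quandle_factor_extension:
  assumes "\<sigma> \<in> carrier (Z_Q X A \<phi> \<psi>)"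
  shows "quandle (factor_extension X A \<phi> \<psi> \<sigma>)" (is "quandle ?F")
proof -
  have \<sigma>: "\<sigma> \<in> carrier (families X A)"
    and \<sigma>_diag: "\<And>x. x \<in> carrier X \<Longrightarrow> \<sigma> (x, x) = \<one>\<^bsub>A x\<^esub>"
    and cocycle: "\<And>x y z. \<lbrakk>x \<in> carrier X; y \<in> carrier X; z \<in> carrier X\<rbrakk> \<Longrightarrow>
      \<sigma> (x \<triangleleft> y, z) \<otimes>\<^bsub>A ((x \<triangleleft> y) \<triangleleft> z)\<^esub> \<phi> (x \<triangleleft> y) z (\<sigma> (x, y)) =
      \<phi> (x \<triangleleft> z) (y \<triangleleft> z) (\<sigma> (x, z)) \<otimes>\<^bsub>A ((x \<triangleleft> y) \<triangleleft> z)\<^esub> \<sigma> (x \<triangleleft> z, y \<triangleleft> z)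
        \<otimes>\<^bsub>A ((x \<triangleleft> y) \<triangleleft> z)\<^esub> \<psi> (y \<triangleleft> z) (x \<triangleleft> z) (\<sigma> (y, z))"
    using assms by (auto simp: carrier_Z_Q_iff)
  have closed: "(a, x) \<triangleleft>\<^bsub>?F\<^esub> (b, y) \<in> carrier ?F"
    if "x \<in> carrier X" "a \<in> carrier (A x)" "y \<in> carrier X" "b \<in> carrier (A y)" for a x b y
  proof -
    interpret group "A (x \<triangleleft> y)" using that by (simp add: group act_closed)
    show ?thesis
      using that \<sigma> by (simp add: act_factor_extension carrier_factor_extension act_closed
          phi_closed psi_closed families_closed)
  qed
  have unique: "\<exists>!u. u \<in> carrier ?F \<and> u \<triangleleft>\<^bsub>?F\<^esub> (b, y) = (a, x)"
    if x: "x \<in> carrier X" and a: "a \<in> carrier (A x)"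
      and y: "y \<in> carrier X" and b: "b \<in> carrier (A y)" for a x b y
  proof -
    obtain w where w: "w \<in> carrier X" "w \<triangleleft> y = x"
      and w_unique: "\<And>v. \<lbrakk>v \<in> carrier X; v \<triangleleft> y = x\<rbrakk> \<Longrightarrow> v = w"
      using act_unique[OF x y] by blast
    interpret comm_group "A x" using x by (rule comm_group)
    have cl: "\<sigma> (w, y) \<in> carrier (A x)" "\<psi> y w b \<in> carrier (A x)"
      using families_closed[OF \<sigma> w(1) y] psi_closed[OF w(1) y b] w(2) by auto
    define d where "d = a \<otimes>\<^bsub>A x\<^esub> inv\<^bsub>A x\<^esub> \<psi> y w b \<otimes>\<^bsub>A x\<^esub> inv\<^bsub>A x\<^esub> \<sigma> (w, y)"
    have d: "d \<in> carrier (A x)" using a cl by (simp add: d_def)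
    have solve: "\<phi> w y c \<otimes>\<^bsub>A x\<^esub> \<sigma> (w, y) \<otimes>\<^bsub>A x\<^esub> \<psi> y w b = a \<longleftrightarrow> \<phi> w y c = d"
      if "c \<in> carrier (A w)" for c
    proof -
      have "\<phi> w y c \<in> carrier (A x)" using phi_closed[OF w(1) y that] w(2) by simp
      then show ?thesis
        using a cl by (auto simp: d_def inv_solve_right inv_solve_right')
    qed
    obtain c where c: "c \<in> carrier (A w)" "\<phi> w y c = d"
      using phi_bij[OF w(1) y] d w(2) by (metis bij_betw_iff_bijections)
    show ?thesis
    proof (rule ex1I[where a = "(c, w)"])
      show "(c, w) \<in> carrier ?F \<and> (c, w) \<triangleleft>\<^bsub>?F\<^esub> (b, y) = (a, x)"
        using c(1) w solve[OF c(1), THEN iffD2, OF c(2)]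
          by (simp add: carrier_factor_extension act_factor_extension)
    next
      fix u assume u: "u \<in> carrier ?F \<and> u \<triangleleft>\<^bsub>?F\<^esub> (b, y) = (a, x)"
      obtain c' v where u_eq: "u = (c', v)" by (cases u)
      then have v: "v = w" and c': "c' \<in> carrier (A w)"
        using u w_unique[of v] by (auto simp: carrier_factor_extension act_factor_extension)
      have "\<phi> w y c' = \<phi> w y c"
        using u c c' solve w(2) by (simp add: u_eq v act_factor_extension)
      then show "u = (c, w)"
        using phi_bij[OF w(1) y] c(1) c' by (auto simp: u_eq v bij_betw_def inj_on_def)
    qed
  qed
  have distrib: "((a, x) \<triangleleft>\<^bsub>?F\<^esub> (b, y)) \<triangleleft>\<^bsub>?F\<^esub> (c, z) =
      ((a, x) \<triangleleft>\<^bsub>?F\<^esub> (c, z)) \<triangleleft>\<^bsub>?F\<^esub> ((b, y) \<triangleleft>\<^bsub>?F\<^esub> (c, z))"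
    if x: "x \<in> carrier X" and a: "a \<in> carrier (A x)" and y: "y \<in> carrier X"
      and b: "b \<in> carrier (A y)" and z: "z \<in> carrier X" and c: "c \<in> carrier (A z)" for a x b y c z
  proof -
    define w where "w = (x \<triangleleft> y) \<triangleleft> z"
    have w: "w \<in> carrier X" using x y z by (simp add: w_def act_closed)
    have w': "(x \<triangleleft> z) \<triangleleft> (y \<triangleleft> z) = w" using act_distrib[OF x y z] by (simp add: w_def)
    interpret G: comm_group "A w" using w by (rule comm_group)
    have X: "x \<triangleleft> y \<in> carrier X" "x \<triangleleft> z \<in> carrier X" "y \<triangleleft> z \<in> carrier X"
      using x y z by (auto simp: act_closed)
    interpret xy: group "A (x \<triangleleft> y)" using X(1) by (rule group)
    interpret xz: group "A (x \<triangleleft> z)" using X(2) by (rule group)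
    interpret yz: group "A (y \<triangleleft> z)" using X(3) by (rule group)
    note s = families_closed[OF \<sigma>]
    note cl = cocycle_terms_closed[OF \<sigma> x y z, folded w_def]
    note phi_w = phi_closed[OF X(1) z, folded w_def] phi_closed[OF X(2,3), unfolded w']
    note psi_w = psi_closed[OF X(1) z, folded w_def] psi_closed[OF X(2,3), unfolded w']
    have "\<phi> (x \<triangleleft> y) z (\<phi> x y a \<otimes>\<^bsub>A (x \<triangleleft> y)\<^esub> \<sigma> (x, y) \<otimes>\<^bsub>A (x \<triangleleft> y)\<^esub> \<psi> y x b)
          \<otimes>\<^bsub>A w\<^esub> \<sigma> (x \<triangleleft> y, z) \<otimes>\<^bsub>A w\<^esub> \<psi> z (x \<triangleleft> y) c
        = \<phi> (x \<triangleleft> z) (y \<triangleleft> z) (\<phi> x z a) \<otimes>\<^bsub>A w\<^esub> \<phi> (x \<triangleleft> y) z (\<sigma> (x, y))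
          \<otimes>\<^bsub>A w\<^esub> \<psi> (y \<triangleleft> z) (x \<triangleleft> z) (\<phi> y z b) \<otimes>\<^bsub>A w\<^esub> \<sigma> (x \<triangleleft> y, z)
          \<otimes>\<^bsub>A w\<^esub> (\<phi> (x \<triangleleft> z) (y \<triangleleft> z) (\<psi> z x c) \<otimes>\<^bsub>A w\<^esub> \<psi> (y \<triangleleft> z) (x \<triangleleft> z) (\<psi> z y c))"
      using x y z a b c X s phi_mult[OF X(1) z, folded w_def] psi_psi[OF x y z c, folded w_def]
      by (simp add: phi_closed psi_closed phi_phi phi_psi)
    also have "\<dots> = \<phi> (x \<triangleleft> z) (y \<triangleleft> z) (\<phi> x z a) \<otimes>\<^bsub>A w\<^esub> \<phi> (x \<triangleleft> z) (y \<triangleleft> z) (\<sigma> (x, z))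
          \<otimes>\<^bsub>A w\<^esub> \<phi> (x \<triangleleft> z) (y \<triangleleft> z) (\<psi> z x c) \<otimes>\<^bsub>A w\<^esub> \<sigma> (x \<triangleleft> z, y \<triangleleft> z)
          \<otimes>\<^bsub>A w\<^esub> (\<psi> (y \<triangleleft> z) (x \<triangleleft> z) (\<phi> y z b) \<otimes>\<^bsub>A w\<^esub> \<psi> (y \<triangleleft> z) (x \<triangleleft> z) (\<sigma> (y, z))
              \<otimes>\<^bsub>A w\<^esub> \<psi> (y \<triangleleft> z) (x \<triangleleft> z) (\<psi> z y c))"
      by (rule G.cocycle_shuffle[OF cocycle[OF x y z, folded w_def]])
        (use x y z a b c cl phi_w psi_w in \<open>auto simp: phi_closed psi_closed\<close>)
    also have "\<dots> = \<phi> (x \<triangleleft> z) (y \<triangleleft> z) (\<phi> x z a \<otimes>\<^bsub>A (x \<triangleleft> z)\<^esub> \<sigma> (x, z) \<otimes>\<^bsub>A (x \<triangleleft> z)\<^esub> \<psi> z x c)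
          \<otimes>\<^bsub>A w\<^esub> \<sigma> (x \<triangleleft> z, y \<triangleleft> z)
          \<otimes>\<^bsub>A w\<^esub> \<psi> (y \<triangleleft> z) (x \<triangleleft> z) (\<phi> y z b \<otimes>\<^bsub>A (y \<triangleleft> z)\<^esub> \<sigma> (y, z) \<otimes>\<^bsub>A (y \<triangleleft> z)\<^esub> \<psi> z y c)"
      using x y z a b c s phi_mult[OF X(2,3), unfolded w'] psi_mult[OF X(2,3), unfolded w']
      by (simp add: phi_closed psi_closed)
    finally show ?thesis
      by (simp add: act_factor_extension w' flip: w_def)
  qed
  have idem: "(a, x) \<triangleleft>\<^bsub>?F\<^esub> (a, x) = (a, x)" if x: "x \<in> carrier X" and a: "a \<in> carrier (A x)" for a x
  proof -
    interpret comm_group "A x" using x by (rule comm_group)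
    have "\<phi> x x a \<in> carrier (A x)" "\<psi> x x a \<in> carrier (A x)"
      using phi_closed[OF x x a] psi_closed[OF x x a] act_idem[OF x] by auto
    then show ?thesis
      using x a psi_phi_idem[OF x a] by (simp add: act_factor_extension act_idem \<sigma>_diag m_comm)
  qed
  show ?thesis
  proof (intro quandle.intro rack.intro quandle_axioms.intro)
    fix u v assume "u \<in> carrier ?F" "v \<in> carrier ?F"
    then show "u \<triangleleft>\<^bsub>?F\<^esub> v \<in> carrier ?F" "\<exists>!c. c \<in> carrier ?F \<and> c \<triangleleft>\<^bsub>?F\<^esub> v = u"
      using closed unique by (cases u; cases v; simp add: carrier_factor_extension)+
    fix t assume "t \<in> carrier ?F"
    then show "(u \<triangleleft>\<^bsub>?F\<^esub> v) \<triangleleft>\<^bsub>?F\<^esub> t = (u \<triangleleft>\<^bsub>?F\<^esub> t) \<triangleleft>\<^bsub>?F\<^esub> (v \<triangleleft>\<^bsub>?F\<^esub> t)"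
      using distrib \<open>u \<in> carrier ?F\<close> \<open>v \<in> carrier ?F\<close>
      by (cases u; cases v; cases t; simp add: carrier_factor_extension)
  next
    fix u assume "u \<in> carrier ?F"
    then show "u \<triangleleft>\<^bsub>?F\<^esub> u = u"
      using idem by (cases u) (simp add: carrier_factor_extension)
  qed
qed

lemma group_action_translation:
  assumes x: "x \<in> carrier X"
  shows "group_action (A x) (fibre (factor_extension X A \<phi> \<psi> \<sigma>) x)
    (gact (factor_extension X A \<phi> \<psi> \<sigma>) x)"
proof -
  interpret group "A x" using x by (rule group)
  let ?S = "carrier (A x) \<times> {x}"
  define t where "t a = (\<lambda>u\<in>?S. (a \<otimes>\<^bsub>A x\<^esub> fst u, x))" for a
  have t: "t a \<in> Bij ?S" if a: "a \<in> carrier (A x)" for a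
  proof -
    have "bij_betw (t a) ?S ?S"
      by (rule bij_betw_byWitness[where f' = "t (inv\<^bsub>A x\<^esub> a)"])
        (use a in \<open>auto simp: t_def m_assoc[symmetric]\<close>)
    then show ?thesis by (simp add: Bij_def t_def)
  qed
  have "t (a \<otimes>\<^bsub>A x\<^esub> b) = t a \<otimes>\<^bsub>BijGroup ?S\<^esub> t b"
    if "a \<in> carrier (A x)" "b \<in> carrier (A x)" for a b
    using t[OF that(1)] t[OF that(2)] that
    by (auto simp: BijGroup_def compose_def t_def m_assoc intro!: restrict_ext)
  then have "t \<in> hom (A x) (BijGroup ?S)"
    using t by (auto simp: hom_def BijGroup_def)
  moreover have "gact (factor_extension X A \<phi> \<psi> \<sigma>) x = t"
    by (simp add: factor_extension_def t_def fun_eq_iff)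
  ultimately show ?thesis
    using x by (simp add: group_action_def group_hom_def group_hom_axioms_def group_BijGroup
        fibre_factor_extension is_group)
qed

text \<open>
  (X2) and (X3) hold because \<open>\<phi> x y\<close> and \<open>\<psi> y x\<close> are additive, and (X1) because a group acts simply
  transitively on itself by translation.
\<close>

theorem quandle_extension_factor_extension:
  assumes Z: "\<sigma> \<in> carrier (Z_Q X A \<phi> \<psi>)"
  shows "quandle_extension X A \<phi> \<psi> (factor_extension X A \<phi> \<psi> \<sigma>)"
proof -
  let ?F = "factor_extension X A \<phi> \<psi> \<sigma>"
  interpret F: quandle ?F using Z by (rule quandle_factor_extension)
  have \<sigma>: "\<sigma> \<in> carrier (families X A)" using Z by (simp add: carrier_Z_Q_iff)
  have "rack_extension_axioms X A \<phi> \<psi> ?F"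
  proof (rule rack_extension_axioms.intro)
    show "proj ?F \<in> rack_hom ?F X"
      by (auto simp: rack_hom_def factor_extension_def)
    show "proj ?F ` carrier ?F = carrier X"
    proof -
      have "x \<in> proj ?F ` carrier ?F" if "x \<in> carrier X" for x
      proof (rule image_eqI[where x = "(\<one>\<^bsub>A x\<^esub>, x)"])
        show "x = proj ?F (\<one>\<^bsub>A x\<^esub>, x)" by (simp add: proj_factor_extension)
        show "(\<one>\<^bsub>A x\<^esub>, x) \<in> carrier ?F"
          using that group[OF that] by (simp add: carrier_factor_extension group.is_monoid)
      qed
      then show ?thesis
        by (auto simp: proj_factor_extension carrier_factor_extension)
    qed
  next
    fix x assume "x \<in> carrier X"
    then show "group_action (A x) (fibre ?F x) (gact ?F x)"
      by (rule group_action_translation)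
  next
    fix x u v assume x: "x \<in> carrier X" and "u \<in> fibre ?F x" "v \<in> fibre ?F x"
    then obtain b c where *: "u = (b, x)" "v = (c, x)" "b \<in> carrier (A x)" "c \<in> carrier (A x)"
      by (auto simp: fibre_factor_extension)
    interpret group "A x" using x by (rule group)
    show "\<exists>!a. a \<in> carrier (A x) \<and> gact ?F x a u = v"
      by (rule ex1I[where a = "c \<otimes>\<^bsub>A x\<^esub> inv\<^bsub>A x\<^esub> b"])
        (use * in \<open>auto simp: gact_factor_extension m_assoc\<close>)
  next
    fix x y u a v
    assume x: "x \<in> carrier X" and y: "y \<in> carrier X" and a: "a \<in> carrier (A x)"
      and "u \<in> fibre ?F x" "v \<in> fibre ?F y"
    then obtain b c where *: "u = (b, x)" "v = (c, y)" "b \<in> carrier (A x)" "c \<in> carrier (A y)"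
      by (auto simp: fibre_factor_extension)
    interpret comm_group "A (x \<triangleleft> y)" using x y by (simp add: comm_group act_closed)
    show "gact ?F x a u \<triangleleft>\<^bsub>?F\<^esub> v = gact ?F (x \<triangleleft> y) (\<phi> x y a) (u \<triangleleft>\<^bsub>?F\<^esub> v)"
      using * x y a \<sigma> by (simp add: gact_factor_extension act_factor_extension phi_mult phi_closed
          psi_closed families_closed m_assoc)
  next
    fix x y u b v
    assume x: "x \<in> carrier X" and y: "y \<in> carrier X" and b: "b \<in> carrier (A y)"
      and "u \<in> fibre ?F x" "v \<in> fibre ?F y"
    then obtain a c where *: "u = (a, x)" "v = (c, y)" "a \<in> carrier (A x)" "c \<in> carrier (A y)"
      by (auto simp: fibre_factor_extension)
    interpret comm_group "A (x \<triangleleft> y)" using x y by (simp add: comm_group act_closed)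
    show "u \<triangleleft>\<^bsub>?F\<^esub> gact ?F y b v = gact ?F (x \<triangleleft> y) (\<psi> y x b) (u \<triangleleft>\<^bsub>?F\<^esub> v)"
      using * x y b \<sigma> by (simp add: gact_factor_extension act_factor_extension psi_mult phi_closed
          psi_closed families_closed m_ac)
  qed
  then show ?thesis
    by (intro quandle_extension.intro rack_extension.intro rack_module_axioms
        F.rack_axioms F.quandle_axioms)
qed

end


section \<open>The group of factor sets modulo coboundaries\<close>

text \<open>
  With \<open>u = \<upsilon> (x \<triangleleft> y)\<close>, \<open>s = \<sigma> (x, y)\<close> and \<open>t = \<tau> (x, y)\<close>, the left side is the condition on a section
  \<open>x \<mapsto> (\<upsilon> x, x)\<close> of $E[\mathcal{A},\tau]$ to have the family \<open>\<sigma>\<close>, and the right side is the equation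
  that exhibits \<open>\<sigma> - \<tau>\<close> as a coboundary.
\<close>

lemma (in comm_group) coboundary_shuffle:
  assumes "p \<in> carrier G" "t \<in> carrier G" "q \<in> carrier G" "s \<in> carrier G" "u \<in> carrier G"
  shows "p \<otimes> t \<otimes> q = s \<otimes> u \<longleftrightarrow> s \<otimes> inv t = p \<otimes> inv u \<otimes> q"
proof -
  have "p \<otimes> t \<otimes> q = s \<otimes> u \<longleftrightarrow> p \<otimes> t \<otimes> q \<otimes> (inv t \<otimes> inv u) = s \<otimes> u \<otimes> (inv t \<otimes> inv u)"
    using assms by simp
  also have "p \<otimes> t \<otimes> q \<otimes> (inv t \<otimes> inv u) = p \<otimes> inv u \<otimes> q \<otimes> (t \<otimes> inv t)"
    using assms(1-3,5) by (simp only: m_ac m_closed inv_closed)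
  also have "s \<otimes> u \<otimes> (inv t \<otimes> inv u) = s \<otimes> inv t \<otimes> (u \<otimes> inv u)"
    using assms by (simp only: m_ac m_closed inv_closed)
  finally show ?thesis
    using assms by auto
qed

context quandle_module
begin

text \<open>
  Sections of $E[\mathcal{A},\tau]$ are the graphs of families \<open>\<upsilon>\<close>. Here \<open>\<sigma>\<close> ranges over all
  families, so that for \<open>\<tau> = 0\<close> the criterion applies to a coboundary before it is known to be a
  factor set.
\<close>

theorem equivalent_factor_extensions_iff:
  assumes \<sigma>: "\<sigma> \<in> carrier (families X A)" and \<tau>: "\<tau> \<in> carrier (Z_Q X A \<phi> \<psi>)"
  shows "ext_equivalent X A (factor_extension X A \<phi> \<psi> \<sigma>) (factor_extension X A \<phi> \<psi> \<tau>)
    \<longleftrightarrow> \<sigma> \<otimes>\<^bsub>families X A\<^esub> inv\<^bsub>families X A\<^esub> \<tau> \<in> B_Q X A \<phi> \<psi>"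
proof -
  let ?E = "factor_extension X A \<phi> \<psi> \<tau>"
  interpret E: quandle_extension X A \<phi> \<psi> ?E
    using \<tau> by (rule quandle_extension_factor_extension)
  interpret Fam: group "families X A" by (rule families_group)
  have \<tau>': "\<tau> \<in> carrier (families X A)" using \<tau> by (simp add: carrier_Z_Q_iff)
  have diff: "\<sigma> \<otimes>\<^bsub>families X A\<^esub> inv\<^bsub>families X A\<^esub> \<tau> \<in> carrier (families X A)"
    using \<sigma> \<tau>' by simp
  have key: "(\<upsilon> x, x) \<triangleleft>\<^bsub>?E\<^esub> (\<upsilon> y, y) = gact ?E (x \<triangleleft> y) (\<sigma> (x, y)) (\<upsilon> (x \<triangleleft> y), x \<triangleleft> y) \<longleftrightarrow>
      (\<sigma> \<otimes>\<^bsub>families X A\<^esub> inv\<^bsub>families X A\<^esub> \<tau>) (x, y) =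
        \<phi> x y (\<upsilon> x) \<otimes>\<^bsub>A (x \<triangleleft> y)\<^esub> inv\<^bsub>A (x \<triangleleft> y)\<^esub> \<upsilon> (x \<triangleleft> y) \<otimes>\<^bsub>A (x \<triangleleft> y)\<^esub> \<psi> y x (\<upsilon> y)"
    if \<upsilon>: "\<And>x. x \<in> carrier X \<Longrightarrow> \<upsilon> x \<in> carrier (A x)"
      and xy: "x \<in> carrier X" "y \<in> carrier X" for \<upsilon> x y
  proof -
    interpret comm_group "A (x \<triangleleft> y)" using xy by (simp add: comm_group act_closed)
    show ?thesis
      using \<upsilon> xy \<sigma> \<tau>' by (simp add: act_factor_extension gact_factor_extension act_closed
          families_mult_apply families_inv_apply families_closed phi_closed psi_closed
          coboundary_shuffle)
  qed
  have "(\<exists>s. E.section_with \<sigma> s) \<longleftrightarrow>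
      (\<exists>\<upsilon>. (\<forall>x\<in>carrier X. \<upsilon> x \<in> carrier (A x)) \<and> E.section_with \<sigma> (\<lambda>x. (\<upsilon> x, x)))"
  proof
    assume "\<exists>s. E.section_with \<sigma> s"
    then obtain s where s: "E.section_with \<sigma> s" ..
    then have fib: "s x \<in> carrier (A x) \<times> {x}" if "x \<in> carrier X" for x
      using that by (simp add: E.section_with_def fibre_factor_extension)
    then have eq: "s x = (fst (s x), x)" if "x \<in> carrier X" for x
      using that by (metis mem_Times_iff prod.collapse singletonD)
    have "E.section_with \<sigma> (\<lambda>x. (fst (s x), x))"
      using s by (simp add: E.section_with_def act_closed flip: eq)
    then show "\<exists>\<upsilon>. (\<forall>x\<in>carrier X. \<upsilon> x \<in> carrier (A x)) \<and> E.section_with \<sigma> (\<lambda>x. (\<upsilon> x, x))"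
      using fib by (intro exI[where x = "\<lambda>x. fst (s x)"]) (auto simp: mem_Times_iff)
  qed blast
  also have "\<dots> \<longleftrightarrow> \<sigma> \<otimes>\<^bsub>families X A\<^esub> inv\<^bsub>families X A\<^esub> \<tau> \<in> B_Q X A \<phi> \<psi>"
    unfolding B_Q_iff E.section_with_def
    using diff key by (auto simp: fibre_factor_extension)
  finally show ?thesis
    using E.equivalent_factor_extension_iff_section[OF \<sigma>] by blast
qed

lemma factor_extension_equivalent_sym:
  assumes "\<sigma> \<in> carrier (Z_Q X A \<phi> \<psi>)"
    and "ext_equivalent X A (factor_extension X A \<phi> \<psi> \<sigma>) E"
  shows "ext_equivalent X A E (factor_extension X A \<phi> \<psi> \<sigma>)"
  using quandle_extension.axioms(1)[OF quandle_extension_factor_extension[OF assms(1)]] assms(2)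
  by (rule rack_extension.ext_equivalent_sym)

lemma Z_Q_eq: "Z_Q X A \<phi> \<psi> = (families X A)\<lparr>carrier := carrier (Z_Q X A \<phi> \<psi>)\<rparr>"
  by (simp add: Z_Q_def)

lemma subgroup_Z_Q: "subgroup (carrier (Z_Q X A \<phi> \<psi>)) (families X A)"
proof -
  interpret Fam: comm_group "families X A" by (rule families_comm_group)
  have one: "\<one>\<^bsub>families X A\<^esub> \<in> carrier (Z_Q X A \<phi> \<psi>)"
  proof -
    have "\<one>\<^bsub>families X A\<^esub> (x, x) = \<one>\<^bsub>A x\<^esub>" if "x \<in> carrier X" for x
      using that by (simp add: families_one_apply act_idem)
    moreover have "\<one>\<^bsub>families X A\<^esub> (x \<triangleleft> y, z)
          \<otimes>\<^bsub>A ((x \<triangleleft> y) \<triangleleft> z)\<^esub> \<phi> (x \<triangleleft> y) z (\<one>\<^bsub>families X A\<^esub> (x, y)) =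
        \<phi> (x \<triangleleft> z) (y \<triangleleft> z) (\<one>\<^bsub>families X A\<^esub> (x, z))
          \<otimes>\<^bsub>A ((x \<triangleleft> y) \<triangleleft> z)\<^esub> \<one>\<^bsub>families X A\<^esub> (x \<triangleleft> z, y \<triangleleft> z)
          \<otimes>\<^bsub>A ((x \<triangleleft> y) \<triangleleft> z)\<^esub> \<psi> (y \<triangleleft> z) (x \<triangleleft> z) (\<one>\<^bsub>families X A\<^esub> (y, z))"
      if "x \<in> carrier X" "y \<in> carrier X" "z \<in> carrier X" for x y z
    proof -
      have X: "x \<triangleleft> y \<in> carrier X" "x \<triangleleft> z \<in> carrier X" "y \<triangleleft> z \<in> carrier X"
        using that by (auto simp: act_closed)
      interpret group "A ((x \<triangleleft> y) \<triangleleft> z)" using X(1) that(3) by (simp add: group act_closed)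
      show ?thesis
        using that X phi_one[OF X(1) that(3)] phi_one[OF X(2,3)] psi_one[OF X(2,3)]
        by (simp add: families_one_apply flip: act_distrib[OF that])
    qed
    ultimately show ?thesis by (simp add: carrier_Z_Q_iff)
  qed
  have mult: "\<sigma> \<otimes>\<^bsub>families X A\<^esub> \<tau> \<in> carrier (Z_Q X A \<phi> \<psi>)"
    if \<sigma>: "\<sigma> \<in> carrier (Z_Q X A \<phi> \<psi>)" and \<tau>: "\<tau> \<in> carrier (Z_Q X A \<phi> \<psi>)" for \<sigma> \<tau>
    unfolding carrier_Z_Q_iff
  proof (intro conjI ballI)
    have fam: "\<sigma> \<in> carrier (families X A)" "\<tau> \<in> carrier (families X A)"
      using \<sigma> \<tau> by (auto simp: carrier_Z_Q_iff)
    then show "\<sigma> \<otimes>\<^bsub>families X A\<^esub> \<tau> \<in> carrier (families X A)" by simp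
    show "(\<sigma> \<otimes>\<^bsub>families X A\<^esub> \<tau>) (x, x) = \<one>\<^bsub>A x\<^esub>" if x: "x \<in> carrier X" for x
    proof -
      interpret group "A x" using x by (rule group)
      show ?thesis
        using x \<sigma> \<tau> by (simp add: families_mult_apply act_idem carrier_Z_Q_iff)
    qed
    fix x y z assume x: "x \<in> carrier X" and y: "y \<in> carrier X" and z: "z \<in> carrier X"
    define w where "w = (x \<triangleleft> y) \<triangleleft> z"
    have w: "w \<in> carrier X" using x y z by (simp add: w_def act_closed)
    have w': "(x \<triangleleft> z) \<triangleleft> (y \<triangleleft> z) = w" using act_distrib[OF x y z] by (simp add: w_def)
    interpret G: comm_group "A w" using w by (rule comm_group)
    have X: "x \<triangleleft> y \<in> carrier X" "x \<triangleleft> z \<in> carrier X" "y \<triangleleft> z \<in> carrier X"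
      using x y z by (auto simp: act_closed)
    have \<sigma>_coc: "\<sigma> (x \<triangleleft> y, z) \<otimes>\<^bsub>A w\<^esub> \<phi> (x \<triangleleft> y) z (\<sigma> (x, y)) =
        \<phi> (x \<triangleleft> z) (y \<triangleleft> z) (\<sigma> (x, z)) \<otimes>\<^bsub>A w\<^esub> \<sigma> (x \<triangleleft> z, y \<triangleleft> z)
          \<otimes>\<^bsub>A w\<^esub> \<psi> (y \<triangleleft> z) (x \<triangleleft> z) (\<sigma> (y, z))"
      using \<sigma> x y z by (simp add: carrier_Z_Q_iff w_def)
    have \<tau>_coc: "\<tau> (x \<triangleleft> y, z) \<otimes>\<^bsub>A w\<^esub> \<phi> (x \<triangleleft> y) z (\<tau> (x, y)) =
        \<phi> (x \<triangleleft> z) (y \<triangleleft> z) (\<tau> (x, z)) \<otimes>\<^bsub>A w\<^esub> \<tau> (x \<triangleleft> z, y \<triangleleft> z)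
          \<otimes>\<^bsub>A w\<^esub> \<psi> (y \<triangleleft> z) (x \<triangleleft> z) (\<tau> (y, z))"
      using \<tau> x y z by (simp add: carrier_Z_Q_iff w_def)
    note cl = cocycle_terms_closed[OF fam(1) x y z, folded w_def]
      cocycle_terms_closed[OF fam(2) x y z, folded w_def]
    note eval = families_mult_apply[OF X(1) z, folded w_def] families_mult_apply[OF X(2,3), unfolded w']
      families_mult_apply[OF x y] families_mult_apply[OF x z] families_mult_apply[OF y z]
    have "(\<sigma> \<otimes>\<^bsub>families X A\<^esub> \<tau>) (x \<triangleleft> y, z)
          \<otimes>\<^bsub>A w\<^esub> \<phi> (x \<triangleleft> y) z ((\<sigma> \<otimes>\<^bsub>families X A\<^esub> \<tau>) (x, y)) =
        (\<sigma> (x \<triangleleft> y, z) \<otimes>\<^bsub>A w\<^esub> \<phi> (x \<triangleleft> y) z (\<sigma> (x, y)))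
          \<otimes>\<^bsub>A w\<^esub> (\<tau> (x \<triangleleft> y, z) \<otimes>\<^bsub>A w\<^esub> \<phi> (x \<triangleleft> y) z (\<tau> (x, y)))"
      using fam x y z X cl phi_mult[OF X(1) z, folded w_def]
      by (simp add: eval families_closed G.m_ac)
    also have "\<dots> = \<phi> (x \<triangleleft> z) (y \<triangleleft> z) ((\<sigma> \<otimes>\<^bsub>families X A\<^esub> \<tau>) (x, z))
          \<otimes>\<^bsub>A w\<^esub> (\<sigma> \<otimes>\<^bsub>families X A\<^esub> \<tau>) (x \<triangleleft> z, y \<triangleleft> z)
          \<otimes>\<^bsub>A w\<^esub> \<psi> (y \<triangleleft> z) (x \<triangleleft> z) ((\<sigma> \<otimes>\<^bsub>families X A\<^esub> \<tau>) (y, z))"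
      unfolding \<sigma>_coc \<tau>_coc
      using fam x y z X cl phi_mult[OF X(2,3), unfolded w'] psi_mult[OF X(2,3), unfolded w']
      by (simp add: eval families_closed G.m_ac)
    finally show "(\<sigma> \<otimes>\<^bsub>families X A\<^esub> \<tau>) (x \<triangleleft> y, z)
          \<otimes>\<^bsub>A ((x \<triangleleft> y) \<triangleleft> z)\<^esub> \<phi> (x \<triangleleft> y) z ((\<sigma> \<otimes>\<^bsub>families X A\<^esub> \<tau>) (x, y)) =
        \<phi> (x \<triangleleft> z) (y \<triangleleft> z) ((\<sigma> \<otimes>\<^bsub>families X A\<^esub> \<tau>) (x, z))
          \<otimes>\<^bsub>A ((x \<triangleleft> y) \<triangleleft> z)\<^esub> (\<sigma> \<otimes>\<^bsub>families X A\<^esub> \<tau>) (x \<triangleleft> z, y \<triangleleft> z)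
          \<otimes>\<^bsub>A ((x \<triangleleft> y) \<triangleleft> z)\<^esub> \<psi> (y \<triangleleft> z) (x \<triangleleft> z) ((\<sigma> \<otimes>\<^bsub>families X A\<^esub> \<tau>) (y, z))"
      by (simp add: w_def)
  qed
  have inv: "inv\<^bsub>families X A\<^esub> \<sigma> \<in> carrier (Z_Q X A \<phi> \<psi>)"
    if \<sigma>: "\<sigma> \<in> carrier (Z_Q X A \<phi> \<psi>)" for \<sigma>
    unfolding carrier_Z_Q_iff
  proof (intro conjI ballI)
    have fam: "\<sigma> \<in> carrier (families X A)"
      using \<sigma> by (simp add: carrier_Z_Q_iff)
    then show "inv\<^bsub>families X A\<^esub> \<sigma> \<in> carrier (families X A)" by simp
    show "(inv\<^bsub>families X A\<^esub> \<sigma>) (x, x) = \<one>\<^bsub>A x\<^esub>" if x: "x \<in> carrier X" for x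
    proof -
      interpret group "A x" using x by (rule group)
      show ?thesis
        using x \<sigma> fam by (simp add: families_inv_apply act_idem carrier_Z_Q_iff)
    qed
    fix x y z assume x: "x \<in> carrier X" and y: "y \<in> carrier X" and z: "z \<in> carrier X"
    define w where "w = (x \<triangleleft> y) \<triangleleft> z"
    have w: "w \<in> carrier X" using x y z by (simp add: w_def act_closed)
    have w': "(x \<triangleleft> z) \<triangleleft> (y \<triangleleft> z) = w" using act_distrib[OF x y z] by (simp add: w_def)
    interpret G: comm_group "A w" using w by (rule comm_group)
    have X: "x \<triangleleft> y \<in> carrier X" "x \<triangleleft> z \<in> carrier X" "y \<triangleleft> z \<in> carrier X"
      using x y z by (auto simp: act_closed)
    have coc: "\<sigma> (x \<triangleleft> y, z) \<otimes>\<^bsub>A w\<^esub> \<phi> (x \<triangleleft> y) z (\<sigma> (x, y)) =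
        \<phi> (x \<triangleleft> z) (y \<triangleleft> z) (\<sigma> (x, z)) \<otimes>\<^bsub>A w\<^esub> \<sigma> (x \<triangleleft> z, y \<triangleleft> z)
          \<otimes>\<^bsub>A w\<^esub> \<psi> (y \<triangleleft> z) (x \<triangleleft> z) (\<sigma> (y, z))"
      using \<sigma> x y z by (simp add: carrier_Z_Q_iff w_def)
    note cl = cocycle_terms_closed[OF fam x y z, folded w_def]
    note eval = families_inv_apply[OF fam X(1) z, folded w_def]
      families_inv_apply[OF fam X(2,3), unfolded w'] families_inv_apply[OF fam x y]
      families_inv_apply[OF fam x z] families_inv_apply[OF fam y z]
      group_hom.hom_inv[OF phi_group_hom[OF X(1) z], folded w_def]
      group_hom.hom_inv[OF phi_group_hom[OF X(2,3)], unfolded w']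
      group_hom.hom_inv[OF psi_group_hom[OF X(2,3)], unfolded w']
    have "(inv\<^bsub>families X A\<^esub> \<sigma>) (x \<triangleleft> y, z)
          \<otimes>\<^bsub>A w\<^esub> \<phi> (x \<triangleleft> y) z ((inv\<^bsub>families X A\<^esub> \<sigma>) (x, y)) =
        inv\<^bsub>A w\<^esub> (\<sigma> (x \<triangleleft> y, z) \<otimes>\<^bsub>A w\<^esub> \<phi> (x \<triangleleft> y) z (\<sigma> (x, y)))"
      using fam x y cl by (simp add: eval families_closed G.inv_mult)
    also have "\<dots> = \<phi> (x \<triangleleft> z) (y \<triangleleft> z) ((inv\<^bsub>families X A\<^esub> \<sigma>) (x, z))
          \<otimes>\<^bsub>A w\<^esub> (inv\<^bsub>families X A\<^esub> \<sigma>) (x \<triangleleft> z, y \<triangleleft> z)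
          \<otimes>\<^bsub>A w\<^esub> \<psi> (y \<triangleleft> z) (x \<triangleleft> z) ((inv\<^bsub>families X A\<^esub> \<sigma>) (y, z))"
      unfolding coc using fam x y z cl by (simp add: eval families_closed G.inv_mult)
    finally show "(inv\<^bsub>families X A\<^esub> \<sigma>) (x \<triangleleft> y, z)
          \<otimes>\<^bsub>A ((x \<triangleleft> y) \<triangleleft> z)\<^esub> \<phi> (x \<triangleleft> y) z ((inv\<^bsub>families X A\<^esub> \<sigma>) (x, y)) =
        \<phi> (x \<triangleleft> z) (y \<triangleleft> z) ((inv\<^bsub>families X A\<^esub> \<sigma>) (x, z))
          \<otimes>\<^bsub>A ((x \<triangleleft> y) \<triangleleft> z)\<^esub> (inv\<^bsub>families X A\<^esub> \<sigma>) (x \<triangleleft> z, y \<triangleleft> z)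
          \<otimes>\<^bsub>A ((x \<triangleleft> y) \<triangleleft> z)\<^esub> \<psi> (y \<triangleleft> z) (x \<triangleleft> z) ((inv\<^bsub>families X A\<^esub> \<sigma>) (y, z))"
      by (simp add: w_def)
  qed
  show ?thesis
  proof (rule Fam.subgroupI)
    show "carrier (Z_Q X A \<phi> \<psi>) \<subseteq> carrier (families X A)"
      by (rule subsetI) (simp add: carrier_Z_Q_iff)
    show "carrier (Z_Q X A \<phi> \<psi>) \<noteq> {}"
      using one by blast
  qed (use mult inv in blast)+
qed

lemma comm_group_Z_Q: "comm_group (Z_Q X A \<phi> \<psi>)"
proof -
  interpret Fam: comm_group "families X A" by (rule families_comm_group)
  have "Group.group (Z_Q X A \<phi> \<psi>)"
    by (subst Z_Q_eq) (rule Fam.subgroup_imp_group[OF subgroup_Z_Q])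
  then show ?thesis
    by (rule group.group_comm_groupI)
      (simp add: Z_Q_def Fam.m_comm)
qed

text \<open>
  For a coboundary \<open>\<sigma>\<close>, $E[\mathcal{A},\sigma]$ is equivalent to the quandle extension
  $E[\mathcal{A},0]$, so \<open>\<sigma>\<close> is the family of a section of a quandle extension.
\<close>

lemma B_Q_subset_Z_Q: "B_Q X A \<phi> \<psi> \<subseteq> carrier (Z_Q X A \<phi> \<psi>)"
proof
  interpret Fam: comm_group "families X A" by (rule families_comm_group)
  let ?E = "factor_extension X A \<phi> \<psi> \<one>\<^bsub>families X A\<^esub>"
  have one: "\<one>\<^bsub>families X A\<^esub> \<in> carrier (Z_Q X A \<phi> \<psi>)"
    using subgroup_Z_Q by (rule subgroup.one_closed)
  interpret E: quandle_extension X A \<phi> \<psi> ?E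
    using one by (rule quandle_extension_factor_extension)
  fix \<sigma> assume "\<sigma> \<in> B_Q X A \<phi> \<psi>"
  moreover from this have \<sigma>: "\<sigma> \<in> carrier (families X A)" by (simp add: B_Q_iff)
  ultimately have "ext_equivalent X A (factor_extension X A \<phi> \<psi> \<sigma>) ?E"
    using equivalent_factor_extensions_iff[OF \<sigma> one] by simp
  then show "\<sigma> \<in> carrier (Z_Q X A \<phi> \<psi>)"
    using E.factor_set_if_section[OF \<sigma>] E.section_if_equivalent_factor_extension[OF \<sigma>] by blast
qed

text \<open>
  Closure under inverses and sums is symmetry and transitivity of equivalence: \<open>\<sigma>\<close> is a coboundary
  iff $E[\mathcal{A},\sigma]$ is equivalent to $E[\mathcal{A},0]$, and adding a coboundary \<open>\<sigma>\<close> to \<open>\<tau>\<close>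
  does not change the equivalence class of $E[\mathcal{A},\tau]$.
\<close>

lemma subgroup_B_Q: "subgroup (B_Q X A \<phi> \<psi>) (Z_Q X A \<phi> \<psi>)"
proof -
  interpret Fam: comm_group "families X A" by (rule families_comm_group)
  interpret Z: subgroup "carrier (Z_Q X A \<phi> \<psi>)" "families X A" by (rule subgroup_Z_Q)
  let ?R = "\<lambda>\<sigma> \<tau>. ext_equivalent X A (factor_extension X A \<phi> \<psi> \<sigma>) (factor_extension X A \<phi> \<psi> \<tau>)"
  have R: "?R \<sigma> \<tau> \<longleftrightarrow> \<sigma> \<otimes>\<^bsub>families X A\<^esub> inv\<^bsub>families X A\<^esub> \<tau> \<in> B_Q X A \<phi> \<psi>"
    if "\<sigma> \<in> carrier (Z_Q X A \<phi> \<psi>)" "\<tau> \<in> carrier (Z_Q X A \<phi> \<psi>)" for \<sigma> \<tau>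
    using that by (intro equivalent_factor_extensions_iff) auto
  have R_one: "\<sigma> \<in> B_Q X A \<phi> \<psi> \<longleftrightarrow> ?R \<sigma> \<one>\<^bsub>families X A\<^esub>" if "\<sigma> \<in> carrier (Z_Q X A \<phi> \<psi>)" for \<sigma>
    using R[OF that Z.one_closed] that by simp
  have "subgroup (B_Q X A \<phi> \<psi>) (families X A)"
  proof (rule Fam.subgroupI)
    show "B_Q X A \<phi> \<psi> \<subseteq> carrier (families X A)"
      using B_Q_subset_Z_Q Z.subset by blast
    show "B_Q X A \<phi> \<psi> \<noteq> {}"
      using R_one[OF Z.one_closed] by (auto simp: ext_equivalent_refl)
    show inv: "inv\<^bsub>families X A\<^esub> \<sigma> \<in> B_Q X A \<phi> \<psi>" if "\<sigma> \<in> B_Q X A \<phi> \<psi>" for \<sigma>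
    proof -
      have \<sigma>: "\<sigma> \<in> carrier (Z_Q X A \<phi> \<psi>)" using that B_Q_subset_Z_Q by blast
      then have "?R \<one>\<^bsub>families X A\<^esub> \<sigma>"
        by (rule factor_extension_equivalent_sym) (use R_one \<sigma> that in blast)
      then show ?thesis using R[OF Z.one_closed \<sigma>] \<sigma> by simp
    qed
    show "\<sigma> \<otimes>\<^bsub>families X A\<^esub> \<tau> \<in> B_Q X A \<phi> \<psi>"
      if "\<sigma> \<in> B_Q X A \<phi> \<psi>" "\<tau> \<in> B_Q X A \<phi> \<psi>" for \<sigma> \<tau>
    proof -
      have Z: "\<sigma> \<in> carrier (Z_Q X A \<phi> \<psi>)" "\<tau> \<in> carrier (Z_Q X A \<phi> \<psi>)"
        using that B_Q_subset_Z_Q by auto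
      have "?R (\<sigma> \<otimes>\<^bsub>families X A\<^esub> \<tau>) \<tau>"
        using R[of "\<sigma> \<otimes>\<^bsub>families X A\<^esub> \<tau>" \<tau>] Z that by (simp add: Fam.m_assoc)
      moreover have "?R \<tau> \<one>\<^bsub>families X A\<^esub>"
        using R_one[OF Z(2)] that(2) by simp
      ultimately have "?R (\<sigma> \<otimes>\<^bsub>families X A\<^esub> \<tau>) \<one>\<^bsub>families X A\<^esub>"
        by (rule ext_equivalent_trans)
      then show ?thesis using R_one Z by simp
    qed
  qed
  then show ?thesis
    by (subst Z_Q_eq) (rule Fam.subgroup_incl[OF _ subgroup_Z_Q B_Q_subset_Z_Q])
qed

lemma B_Q_coset_iff:
  assumes \<sigma>: "\<sigma> \<in> carrier (Z_Q X A \<phi> \<psi>)" and \<tau>: "\<tau> \<in> carrier (Z_Q X A \<phi> \<psi>)"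
  shows "\<sigma> \<in> B_Q X A \<phi> \<psi> #>\<^bsub>Z_Q X A \<phi> \<psi>\<^esub> \<tau> \<longleftrightarrow>
    ext_equivalent X A (factor_extension X A \<phi> \<psi> \<sigma>) (factor_extension X A \<phi> \<psi> \<tau>)"
proof -
  interpret Fam: comm_group "families X A" by (rule families_comm_group)
  interpret Z: comm_group "Z_Q X A \<phi> \<psi>" by (rule comm_group_Z_Q)
  have "\<sigma> \<otimes>\<^bsub>Z_Q X A \<phi> \<psi>\<^esub> inv\<^bsub>Z_Q X A \<phi> \<psi>\<^esub> \<tau> = \<sigma> \<otimes>\<^bsub>families X A\<^esub> inv\<^bsub>families X A\<^esub> \<tau>"
    using Fam.m_inv_consistent[OF subgroup_Z_Q \<tau>] by (simp add: Z_Q_def)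
  then show ?thesis
    using subgroup.rcos_module[OF subgroup_B_Q Z.is_group \<tau> \<sigma>]
      equivalent_factor_extensions_iff[OF _ \<tau>] \<sigma> by (simp add: carrier_Z_Q_iff)
qed

lemma carrier_Ext_Q:
  "carrier (Ext_Q X A \<phi> \<psi>)
    = (\<lambda>\<sigma>. B_Q X A \<phi> \<psi> #>\<^bsub>Z_Q X A \<phi> \<psi>\<^esub> \<sigma>) ` carrier (Z_Q X A \<phi> \<psi>)"
  by (simp add: Ext_Q_def carrier_FactGroup)

theorem quandle_extension_equivalent_to_factor_extension:
  assumes "quandle_extension X A \<phi> \<psi> E"
  shows "\<exists>\<sigma>\<in>carrier (Z_Q X A \<phi> \<psi>). ext_equivalent X A (factor_extension X A \<phi> \<psi> \<sigma>) E"
proof -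
  interpret E: quandle_extension X A \<phi> \<psi> E by fact
  show ?thesis
    using E.exists_section E.factor_set_if_section E.equivalent_factor_extension_if_section by blast
qed

text \<open>
  The elements of the extension \<open>E\<close> may have any type here, so this describes all extensions,
  whereas the bijection below needs a fixed type in which the extensions form a set.
\<close>

theorem ex1_Ext_Q_class:
  assumes "quandle_extension X A \<phi> \<psi> E"
  shows "\<exists>!c. c \<in> carrier (Ext_Q X A \<phi> \<psi>) \<and> (\<forall>\<sigma>\<in>carrier (Z_Q X A \<phi> \<psi>).
    \<sigma> \<in> c \<longleftrightarrow> ext_equivalent X A (factor_extension X A \<phi> \<psi> \<sigma>) E)"
proof -
  interpret E: quandle_extension X A \<phi> \<psi> E by fact
  interpret Z: comm_group "Z_Q X A \<phi> \<psi>" by (rule comm_group_Z_Q)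
  obtain \<tau> where \<tau>: "\<tau> \<in> carrier (Z_Q X A \<phi> \<psi>)"
    and equiv: "ext_equivalent X A (factor_extension X A \<phi> \<psi> \<tau>) E"
    using quandle_extension_equivalent_to_factor_extension[OF assms] by blast
  have equiv': "ext_equivalent X A E (factor_extension X A \<phi> \<psi> \<tau>)"
    using \<tau> equiv by (rule factor_extension_equivalent_sym)
  have sub: "c \<subseteq> carrier (Z_Q X A \<phi> \<psi>)" if "c \<in> carrier (Ext_Q X A \<phi> \<psi>)" for c
    using that Z.r_coset_subset_G[OF subgroup.subset[OF subgroup_B_Q]]
    by (auto simp: carrier_Ext_Q)
  show ?thesis
  proof (rule ex1I[where a = "B_Q X A \<phi> \<psi> #>\<^bsub>Z_Q X A \<phi> \<psi>\<^esub> \<tau>"])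
    show *: "B_Q X A \<phi> \<psi> #>\<^bsub>Z_Q X A \<phi> \<psi>\<^esub> \<tau> \<in> carrier (Ext_Q X A \<phi> \<psi>) \<and>
      (\<forall>\<sigma>\<in>carrier (Z_Q X A \<phi> \<psi>). \<sigma> \<in> B_Q X A \<phi> \<psi> #>\<^bsub>Z_Q X A \<phi> \<psi>\<^esub> \<tau> \<longleftrightarrow>
        ext_equivalent X A (factor_extension X A \<phi> \<psi> \<sigma>) E)"
      using \<tau> ext_equivalent_trans[OF _ equiv] ext_equivalent_trans[OF _ equiv']
      by (auto simp: carrier_Ext_Q B_Q_coset_iff)
    fix c assume "c \<in> carrier (Ext_Q X A \<phi> \<psi>) \<and> (\<forall>\<sigma>\<in>carrier (Z_Q X A \<phi> \<psi>).
      \<sigma> \<in> c \<longleftrightarrow> ext_equivalent X A (factor_extension X A \<phi> \<psi> \<sigma>) E)"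
    with * sub show "c = B_Q X A \<phi> \<psi> #>\<^bsub>Z_Q X A \<phi> \<psi>\<^esub> \<tau>"
      by blast
  qed
qed

theorem Ext_Q_bij_betw_equivalence_classes:
  "\<exists>\<Phi>. bij_betw \<Phi> (carrier (Ext_Q X A \<phi> \<psi>))
         (quandle_extensions X A \<phi> \<psi> // ext_rel X A \<phi> \<psi>)
     \<and> (\<forall>\<sigma>\<in>carrier (Z_Q X A \<phi> \<psi>). \<Phi> (B_Q X A \<phi> \<psi> #>\<^bsub>Z_Q X A \<phi> \<psi>\<^esub> \<sigma>)
            = ext_rel X A \<phi> \<psi> `` {factor_extension X A \<phi> \<psi> \<sigma>})"
  (is "\<exists>\<Phi>. bij_betw \<Phi> _ (?Q // _) \<and> _")
proof -
  interpret Z: comm_group "Z_Q X A \<phi> \<psi>" by (rule comm_group_Z_Q)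
  let ?Z = "carrier (Z_Q X A \<phi> \<psi>)"
  let ?F = "factor_extension X A \<phi> \<psi>"
  let ?c = "\<lambda>\<sigma>. B_Q X A \<phi> \<psi> #>\<^bsub>Z_Q X A \<phi> \<psi>\<^esub> \<sigma>"
  note equiv = equiv_ext_rel[of X A \<phi> \<psi>]
  \<comment> \<open>applying \<open>ext_rel\<close> to the whole coset avoids a choice of representative\<close>
  define \<Phi> where "\<Phi> c = ext_rel X A \<phi> \<psi> `` (?F ` c)" for c
  have F: "?F \<sigma> \<in> ?Q" if "\<sigma> \<in> ?Z" for \<sigma>
    using that quandle_extension_factor_extension by (simp add: quandle_extensions_def)
  have rel_iff: "(?F \<sigma>, ?F \<tau>) \<in> ext_rel X A \<phi> \<psi> \<longleftrightarrow> \<sigma> \<in> ?c \<tau>" if "\<sigma> \<in> ?Z" "\<tau> \<in> ?Z" for \<sigma> \<tau>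
    using that F by (simp add: ext_rel_def B_Q_coset_iff)
  have \<Phi>: "\<Phi> (?c \<sigma>) = ext_rel X A \<phi> \<psi> `` {?F \<sigma>}" if \<sigma>: "\<sigma> \<in> ?Z" for \<sigma>
  proof -
    have "ext_rel X A \<phi> \<psi> `` {?F \<tau>} = ext_rel X A \<phi> \<psi> `` {?F \<sigma>}" if "\<tau> \<in> ?c \<sigma>" for \<tau>
    proof (rule equiv_class_eq[OF equiv])
      have "\<tau> \<in> ?Z"
        using that Z.r_coset_subset_G[OF subgroup.subset[OF subgroup_B_Q] \<sigma>] by blast
      then show "(?F \<tau>, ?F \<sigma>) \<in> ext_rel X A \<phi> \<psi>"
        using that \<sigma> rel_iff by blast
    qed
    moreover have "\<sigma> \<in> ?c \<sigma>"
      using \<sigma> subgroup_B_Q by (rule Z.rcos_self)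
    ultimately show ?thesis
      unfolding \<Phi>_def by blast
  qed
  have "inj_on \<Phi> (carrier (Ext_Q X A \<phi> \<psi>))"
  proof (rule inj_onI)
    fix c d assume "c \<in> carrier (Ext_Q X A \<phi> \<psi>)" "d \<in> carrier (Ext_Q X A \<phi> \<psi>)" and eq: "\<Phi> c = \<Phi> d"
    then obtain \<sigma> \<tau> where c: "c = ?c \<sigma>" "\<sigma> \<in> ?Z" and d: "d = ?c \<tau>" "\<tau> \<in> ?Z"
      by (auto simp: carrier_Ext_Q)
    have "(?F \<sigma>, ?F \<tau>) \<in> ext_rel X A \<phi> \<psi>"
      using eq c d \<Phi> F by (intro eq_equiv_class[OF _ equiv]) auto
    then have "\<sigma> \<in> ?c \<tau>"
      using c d rel_iff by blast
    then show "c = d"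
      using c(1) d Z.repr_independence[OF _ d(2) subgroup_B_Q] by simp
  qed
  moreover have "\<Phi> ` carrier (Ext_Q X A \<phi> \<psi>) = ?Q // ext_rel X A \<phi> \<psi>"
  proof
    show "\<Phi> ` carrier (Ext_Q X A \<phi> \<psi>) \<subseteq> ?Q // ext_rel X A \<phi> \<psi>"
      using F by (auto simp: carrier_Ext_Q \<Phi> intro!: quotientI)
    show "?Q // ext_rel X A \<phi> \<psi> \<subseteq> \<Phi> ` carrier (Ext_Q X A \<phi> \<psi>)"
    proof
      fix K assume "K \<in> ?Q // ext_rel X A \<phi> \<psi>"
      then obtain E where E: "E \<in> ?Q" and K: "K = ext_rel X A \<phi> \<psi> `` {E}"
        by (rule quotientE)
      obtain \<sigma> where \<sigma>: "\<sigma> \<in> ?Z" "ext_equivalent X A (?F \<sigma>) E"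
        using quandle_extension_equivalent_to_factor_extension E
        unfolding quandle_extensions_def by blast
      then have "(?F \<sigma>, E) \<in> ext_rel X A \<phi> \<psi>"
        using E F by (simp add: ext_rel_def)
      then have "ext_rel X A \<phi> \<psi> `` {?F \<sigma>} = ext_rel X A \<phi> \<psi> `` {E}"
        by (rule equiv_class_eq[OF equiv])
      then have "K = \<Phi> (?c \<sigma>)"
        using K \<Phi>[OF \<sigma>(1)] by simp
      then show "K \<in> \<Phi> ` carrier (Ext_Q X A \<phi> \<psi>)"
        using \<sigma>(1) by (auto simp: carrier_Ext_Q)
    qed
  qed
  ultimately show ?thesis
    using \<Phi> unfolding bij_betw_def by blast
qed

end

theorem theorem3p6:
  fixes X :: "('x, 'r) rack_scheme"
    and A :: "'x \<Rightarrow> ('a, 'm) monoid_scheme"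
    and \<phi> \<psi> :: "'x \<Rightarrow> 'x \<Rightarrow> 'a \<Rightarrow> 'a"
  assumes "quandle X"
    and "quandle_module X A \<phi> \<psi>"
  shows "comm_group (Z_Q X A \<phi> \<psi>)
    \<and> subgroup (B_Q X A \<phi> \<psi>) (Z_Q X A \<phi> \<psi>)
    \<and> comm_group (Ext_Q X A \<phi> \<psi>)
    \<and> (\<forall>\<sigma>\<in>carrier (Z_Q X A \<phi> \<psi>). quandle_extension X A \<phi> \<psi> (factor_extension X A \<phi> \<psi> \<sigma>))
    \<and> equiv (quandle_extensions X A \<phi> \<psi> :: ('a \<times> 'x, 'x, 'a) extension set) (ext_rel X A \<phi> \<psi>)
    \<and> (\<exists>\<Phi>. bij_betw \<Phi> (carrier (Ext_Q X A \<phi> \<psi>))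
               ((quandle_extensions X A \<phi> \<psi> :: ('a \<times> 'x, 'x, 'a) extension set)
                  // ext_rel X A \<phi> \<psi>)
           \<and> (\<forall>\<sigma>\<in>carrier (Z_Q X A \<phi> \<psi>).
               \<Phi> (B_Q X A \<phi> \<psi> #>\<^bsub>Z_Q X A \<phi> \<psi>\<^esub> \<sigma>)
                 = ext_rel X A \<phi> \<psi> `` {factor_extension X A \<phi> \<psi> \<sigma>}))
    \<and> (\<forall>E :: ('e, 'x, 'a) extension. quandle_extension X A \<phi> \<psi> E \<longrightarrow>
           (\<exists>!c. c \<in> carrier (Ext_Q X A \<phi> \<psi>)
              \<and> (\<forall>\<sigma>\<in>carrier (Z_Q X A \<phi> \<psi>).
                    \<sigma> \<in> c \<longleftrightarrow> ext_equivalent X A (factor_extension X A \<phi> \<psi> \<sigma>) E)))"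
proof -
  interpret quandle_module X A \<phi> \<psi> by fact
  have "comm_group (Ext_Q X A \<phi> \<psi>)"
    unfolding Ext_Q_def by (rule comm_group.abelian_FactGroup[OF comm_group_Z_Q subgroup_B_Q])
  then show ?thesis
    by (intro conjI ballI allI impI comm_group_Z_Q subgroup_B_Q equiv_ext_rel
        quandle_extension_factor_extension Ext_Q_bij_betw_equivalence_classes ex1_Ext_Q_class)
qed

end
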